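(* There exist Legendrian knot types $\mathscr L$ in the standard contact $\mathbb R^3$ so that for the corresponding smooth knot type $\mathscr K\supset\mathscr L$, the homomorphism $\pi_1(\mathscr L)\to\pi_1(\mathscr K)$ induced by the inclusion is not injective.
   Context: $\mathbb R^3$ carries the standard contact form $\alpha=dz-y\,dx$. A Legendrian knot is an embedded closed curve everywhere tangent to $\ker\alpha$. $\mathrm{Leg}(S^1,\mathbb R^3)$ (respectively $\mathrm{Emb}(S^1,\mathbb R^3)$) is the space of Legendrian (respectively smooth) knots modulo reparametrization, with the quotient of the $C^\infty$ topology. A Legendrian (smooth) knot type is a connected component of $\mathrm{Leg}(S^1,\mathbb R^3)$ (respectively $\mathrm{Emb}(S^1,\mathbb R^3)$). *)

theory Defs
  imports "HOL-Analysis.Analysis" "HOL-Algebra.Group"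
begin

section \<open>Fundamental groups and quotients of abstract topologies\<close>

text \<open>
  The library develops path homotopy only for subsets of spaces in class
  \<open>topological_space\<close>. Spaces of knots are values of type \<open>'a topology\<close>, so loops,
  concatenation and the fundamental group are set up for these, on top of the library's
  \<open>pathin\<close> and \<open>homotopic_with\<close>. A loop is a function on \<open>real\<close> of which only the
  restriction to \<open>{0..1}\<close> matters: functions agreeing there are homotopic.
\<close>

definition loops :: "'a topology \<Rightarrow> 'a \<Rightarrow> (real \<Rightarrow> 'a) set"
  where "loops X x = {p. pathin X p \<and> p 0 = x \<and> p 1 = x}"

definition loop_homotopic :: "'a topology \<Rightarrow> 'a \<Rightarrow> (real \<Rightarrow> 'a) \<Rightarrow> (real \<Rightarrow> 'a) \<Rightarrow> bool"
  where "loop_homotopic X x p q \<longleftrightarrow>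
    homotopic_with (\<lambda>h. h 0 = x \<and> h 1 = x) (top_of_set {0..1}) X p q"

definition loop_class :: "'a topology \<Rightarrow> 'a \<Rightarrow> (real \<Rightarrow> 'a) \<Rightarrow> (real \<Rightarrow> 'a) set"
  where "loop_class X x p = {q. loop_homotopic X x p q}"

definition loop_concat :: "(real \<Rightarrow> 'a) \<Rightarrow> (real \<Rightarrow> 'a) \<Rightarrow> real \<Rightarrow> 'a"
  where "loop_concat p q = (\<lambda>t. if t \<le> 1/2 then p (2 * t) else q (2 * t - 1))"

definition fundamental_group :: "'a topology \<Rightarrow> 'a \<Rightarrow> (real \<Rightarrow> 'a) set monoid"
  where "fundamental_group X x =
    \<lparr>carrier = loop_class X x ` loops X x,
     mult = (\<lambda>A B. \<Union>p\<in>A. \<Union>q\<in>B. loop_class X x (loop_concat p q)),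
     one = loop_class X x (\<lambda>_. x)\<rparr>"

text \<open>The homomorphism \<open>[p] \<mapsto> [f \<circ> p]\<close> from \<open>\<pi>\<^sub>1(X, x)\<close> to \<open>\<pi>\<^sub>1(Y, f x)\<close>.\<close>

definition fundamental_group_map ::
    "'b topology \<Rightarrow> ('a \<Rightarrow> 'b) \<Rightarrow> 'a \<Rightarrow> (real \<Rightarrow> 'a) set \<Rightarrow> (real \<Rightarrow> 'b) set"
  where "fundamental_group_map Y f x A = (\<Union>p\<in>A. loop_class Y (f x) (f \<circ> p))"

definition quotient_topology :: "'a topology \<Rightarrow> ('a \<Rightarrow> 'b) \<Rightarrow> 'b topology"
  where "quotient_topology X f =
    topology (\<lambda>U. U \<subseteq> f ` topspace X \<and> openin X {x \<in> topspace X. f x \<in> U})"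

lemma openin_quotient_topology:
  "openin (quotient_topology X f) U \<longleftrightarrow>
     U \<subseteq> f ` topspace X \<and> openin X {x \<in> topspace X. f x \<in> U}"
proof -
  have "istopology (\<lambda>U. U \<subseteq> f ` topspace X \<and> openin X {x \<in> topspace X. f x \<in> U})"
    unfolding istopology_def
  proof (intro conjI allI impI; (elim conjE)?)
    fix S T
    assume "openin X {x \<in> topspace X. f x \<in> S}" "openin X {x \<in> topspace X. f x \<in> T}"
    then have "openin X ({x \<in> topspace X. f x \<in> S} \<inter> {x \<in> topspace X. f x \<in> T})"
      by blast
    moreover have "{x \<in> topspace X. f x \<in> S} \<inter> {x \<in> topspace X. f x \<in> T}
        = {x \<in> topspace X. f x \<in> S \<inter> T}" by auto
    ultimately show "openin X {x \<in> topspace X. f x \<in> S \<inter> T}" by simp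
  next
    fix K
    assume *: "\<forall>U\<in>K. U \<subseteq> f ` topspace X \<and> openin X {x \<in> topspace X. f x \<in> U}"
    then have "openin X (\<Union>U\<in>K. {x \<in> topspace X. f x \<in> U})" by blast
    moreover have "(\<Union>U\<in>K. {x \<in> topspace X. f x \<in> U}) = {x \<in> topspace X. f x \<in> \<Union>K}" by auto
    ultimately show "openin X {x \<in> topspace X. f x \<in> \<Union>K}" by simp
    show "\<Union>K \<subseteq> f ` topspace X" using * by blast
  qed auto
  then show ?thesis
    unfolding quotient_topology_def by (simp add: topology_inverse')
qed

lemma topspace_quotient_topology [simp]:
  "topspace (quotient_topology X f) = f ` topspace X"
proof -
  have "{x \<in> topspace X. f x \<in> f ` topspace X} = topspace X" by auto
  then have "openin (quotient_topology X f) (f ` topspace X)"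
    by (simp add: openin_quotient_topology)
  then show ?thesis
    by (meson openin_quotient_topology openin_subset openin_topspace subset_antisym)
qed

lemma quotient_map_quotient_topology: "quotient_map X (quotient_topology X f) f"
  by (auto simp: quotient_map_def openin_quotient_topology)


subsection \<open>The group axioms and functoriality\<close>

lemma loop_homotopic_sym: "loop_homotopic X x p q \<Longrightarrow> loop_homotopic X x q p"
  unfolding loop_homotopic_def by (rule homotopic_with_symD)

lemma loop_homotopic_trans:
  "loop_homotopic X x p q \<Longrightarrow> loop_homotopic X x q r \<Longrightarrow> loop_homotopic X x p r"
  unfolding loop_homotopic_def by (rule homotopic_with_trans)

lemma loop_homotopic_refl: "p \<in> loops X x \<Longrightarrow> loop_homotopic X x p p"
  by (simp add: loop_homotopic_def loops_def pathin_def)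

lemma loop_homotopic_loops: "loop_homotopic X x p q \<Longrightarrow> p \<in> loops X x \<and> q \<in> loops X x"
  unfolding loop_homotopic_def loops_def pathin_def
  by (auto dest: homotopic_with_imp_continuous_maps homotopic_with_imp_property)

lemma loop_class_eqI: "loop_homotopic X x p q \<Longrightarrow> loop_class X x p = loop_class X x q"
  unfolding loop_class_def by (blast intro: loop_homotopic_trans loop_homotopic_sym)

lemma loop_class_self: "p \<in> loops X x \<Longrightarrow> p \<in> loop_class X x p"
  by (simp add: loop_class_def loop_homotopic_refl)

lemma loop_class_eq_iff:
  "q \<in> loops X x \<Longrightarrow> loop_class X x p = loop_class X x q \<longleftrightarrow> loop_homotopic X x p q"
  by (metis loop_class_def loop_class_eqI loop_class_self mem_Collect_eq)

lemma continuous_map_half1: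
  "continuous_map (subtopology (prod_topology (top_of_set {0..1::real}) (top_of_set {0..1::real}))
     {z \<in> topspace (prod_topology (top_of_set {0..1}) (top_of_set {0..1})). snd z \<le> 1/2})
     (prod_topology (top_of_set {0..1}) (top_of_set {0..1})) (\<lambda>z. (fst z, 2 * snd z))"
  by (simp add: prod_topology_subtopology_eu subtopology_subtopology)
     (auto intro!: continuous_intros)

lemma continuous_map_half2:
  "continuous_map (subtopology (prod_topology (top_of_set {0..1::real}) (top_of_set {0..1::real}))
     {z \<in> topspace (prod_topology (top_of_set {0..1}) (top_of_set {0..1})). 1/2 \<le> snd z})
     (prod_topology (top_of_set {0..1}) (top_of_set {0..1})) (\<lambda>z. (fst z, 2 * snd z - 1))"
  by (simp add: prod_topology_subtopology_eu subtopology_subtopology)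
     (auto intro!: continuous_intros)

lemma loop_homotopic_concat:
  assumes "loop_homotopic X x p p'" "loop_homotopic X x q q'"
  shows "loop_homotopic X x (loop_concat p q) (loop_concat p' q')"
proof -
  let ?I = "top_of_set {0..1::real}"
  obtain h k where h: "continuous_map (prod_topology ?I ?I) X h"
      "\<And>t. h (0, t) = p t" "\<And>t. h (1, t) = p' t" "\<And>s. s \<in> {0..1} \<Longrightarrow> h (s, 0) = x \<and> h (s, 1) = x"
    and k: "continuous_map (prod_topology ?I ?I) X k"
      "\<And>t. k (0, t) = q t" "\<And>t. k (1, t) = q' t" "\<And>s. s \<in> {0..1} \<Longrightarrow> k (s, 0) = x \<and> k (s, 1) = x"
    using assms unfolding loop_homotopic_def homotopic_with_def by auto
  define g where "g = (\<lambda>z. if snd z \<le> 1/2 then (h \<circ> (\<lambda>z. (fst z, 2 * snd z))) z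
                           else (k \<circ> (\<lambda>z. (fst z, 2 * snd z - 1))) z)"
  have "continuous_map (prod_topology ?I ?I) X g"
    unfolding g_def
  proof (rule continuous_map_cases_le)
    show "continuous_map (prod_topology ?I ?I) euclideanreal snd"
      using continuous_map_in_subtopology continuous_map_snd by blast
    show "continuous_map (prod_topology ?I ?I) euclideanreal (\<lambda>z. 1/2)" by simp
    show "continuous_map (subtopology (prod_topology ?I ?I)
        {z \<in> topspace (prod_topology ?I ?I). snd z \<le> 1/2}) X (h \<circ> (\<lambda>z. (fst z, 2 * snd z)))"
      by (rule continuous_map_compose[OF continuous_map_half1 h(1)])
    show "continuous_map (subtopology (prod_topology ?I ?I)
        {z \<in> topspace (prod_topology ?I ?I). 1/2 \<le> snd z}) X (k \<circ> (\<lambda>z. (fst z, 2 * snd z - 1)))"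
      by (rule continuous_map_compose[OF continuous_map_half2 k(1)])
  next
    fix z assume z: "z \<in> topspace (prod_topology ?I ?I)" "snd z = 1/2"
    then have "fst z \<in> {0..1}" by auto
    then show "(h \<circ> (\<lambda>z. (fst z, 2 * snd z))) z = (k \<circ> (\<lambda>z. (fst z, 2 * snd z - 1))) z"
      using h(4) k(4) unfolding o_def z(2) by simp
  qed
  then show ?thesis
    unfolding loop_homotopic_def homotopic_with_def
    by (intro exI[of _ g]) (use h k in \<open>auto simp: g_def loop_concat_def\<close>)
qed

lemma loop_concat_loops:
  "p \<in> loops X x \<Longrightarrow> q \<in> loops X x \<Longrightarrow> loop_concat p q \<in> loops X x"
  by (meson loop_homotopic_concat loop_homotopic_loops loop_homotopic_refl)

lemma const_loops: "x \<in> topspace X \<Longrightarrow> (\<lambda>_. x) \<in> loops X x"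
  by (simp add: loops_def pathin_def)

lemma loop_homotopic_reparam:
  assumes p: "p \<in> loops X x"
    and a: "continuous_on {0..1} a" "a ` {0..1} \<subseteq> {0..1}"
    and b: "continuous_on {0..1} b" "b ` {0..1} \<subseteq> {0..1}"
    and ends: "a 0 = b 0" "a 1 = b 1" "a 0 \<in> {0, 1}" "a 1 \<in> {0, 1::real}"
  shows "loop_homotopic X x (p \<circ> a) (p \<circ> b)"
  unfolding loop_homotopic_def
proof (rule homotopic_with_compose_continuous_map_left)
  show "continuous_map (top_of_set {0..1}) X p" using p by (simp add: loops_def pathin_def)
  let ?h = "\<lambda>z::real\<times>real. (1 - fst z) * a (snd z) + fst z * b (snd z)"
  have "continuous_on ({0..1} \<times> {0..1}) ?h"
    by (intro continuous_intros continuous_on_compose2[OF a(1)] continuous_on_compose2[OF b(1)]) auto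
  moreover have "?h z \<in> {0..1}" if "z \<in> {0..1} \<times> {0..1}" for z
  proof -
    have "a (snd z) \<in> {0..1}" "b (snd z) \<in> {0..1}" "fst z \<in> {0..1}" using a b that by auto
    then show ?thesis
      using convex_real_interval(5)[of 0 1]
      unfolding convex_alt by auto
  qed
  ultimately have "continuous_map (prod_topology (top_of_set {0..1}) (top_of_set {0..1}))
      (top_of_set {0..1}) ?h"
    by (auto simp: prod_topology_subtopology_eu)
  then show "homotopic_with (\<lambda>h. h 0 = a 0 \<and> h 1 = a 1)
      (top_of_set {0..1}) (top_of_set {0..1}) a b"
    unfolding homotopic_with_def
    by (intro exI[of _ ?h]) (use ends in \<open>auto simp: algebra_simps\<close>)
  show "\<And>j. j 0 = a 0 \<and> j 1 = a 1 \<Longrightarrow> (p \<circ> j) 0 = x \<and> (p \<circ> j) 1 = x"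
    using p ends by (auto simp: loops_def)
qed

lemma loop_concat_assoc:
  assumes "p \<in> loops X x" "q \<in> loops X x" "r \<in> loops X x"
  shows "loop_homotopic X x (loop_concat (loop_concat p q) r) (loop_concat p (loop_concat q r))"
proof -
  let ?a = "\<lambda>t::real. min (min (2 * t) (t + 1/4)) ((t + 1) / 2)"
  let ?l = "loop_concat p (loop_concat q r)"
  have "loop_homotopic X x (?l \<circ> ?a) (?l \<circ> (\<lambda>t. t))"
    by (rule loop_homotopic_reparam)
       (use assms in \<open>auto intro!: loop_concat_loops continuous_intros simp: min_le_iff_disj\<close>)
  moreover have "?l \<circ> ?a = loop_concat (loop_concat p q) r"
  proof
    fix t :: real
    consider "t \<le> 1/4" | "1/4 < t" "t \<le> 1/2" | "1/2 < t" by linarith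
    then show "(?l \<circ> ?a) t = loop_concat (loop_concat p q) r t"
    proof cases
      case 1
      then have "?a t = 2 * t" by auto
      with 1 show ?thesis by (simp add: loop_concat_def)
    next
      case 2
      then have "?a t = t + 1/4" by auto
      with 2 show ?thesis by (simp add: loop_concat_def algebra_simps)
    next
      case 3
      then have "?a t = (t + 1) / 2" by auto
      moreover have "2 * ((t + 1) / 2) - 1 = t" by (simp add: field_simps)
      ultimately show ?thesis using 3 by (simp add: loop_concat_def)
    qed
  qed
  ultimately show ?thesis by (simp add: o_def)
qed

lemma loop_concat_const_left:
  assumes "p \<in> loops X x"
  shows "loop_homotopic X x (loop_concat (\<lambda>_. x) p) p"
proof -
  have "loop_homotopic X x (p \<circ> (\<lambda>t. max 0 (2 * t - 1))) (p \<circ> (\<lambda>t. t))"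
    by (rule loop_homotopic_reparam) (use assms in \<open>auto intro!: continuous_intros\<close>)
  moreover have "p \<circ> (\<lambda>t. max 0 (2 * t - 1)) = loop_concat (\<lambda>_. x) p"
  proof
    fix t :: real
    show "(p \<circ> (\<lambda>t. max 0 (2 * t - 1))) t = loop_concat (\<lambda>_. x) p t"
      using assms by (cases "t \<le> 1/2") (auto simp: loop_concat_def loops_def)
  qed
  ultimately show ?thesis by (simp add: o_def)
qed

lemma loop_concat_reverse:
  assumes "p \<in> loops X x"
  shows "loop_homotopic X x (loop_concat (\<lambda>t. p (1 - t)) p) (\<lambda>_. x)"
proof -
  have "loop_homotopic X x (p \<circ> (\<lambda>t. max (1 - 2 * t) (2 * t - 1))) (p \<circ> (\<lambda>t. 1))"
    by (rule loop_homotopic_reparam) (use assms in \<open>auto intro!: continuous_intros\<close>)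
  moreover have "p \<circ> (\<lambda>t. max (1 - 2 * t) (2 * t - 1)) = loop_concat (\<lambda>t. p (1 - t)) p"
  proof
    fix t :: real
    show "(p \<circ> (\<lambda>t. max (1 - 2 * t) (2 * t - 1))) t = loop_concat (\<lambda>t. p (1 - t)) p t"
    proof (cases "t \<le> 1/2")
      case True
      then have "max (1 - 2 * t) (2 * t - 1) = 1 - 2 * t" by auto
      with True show ?thesis by (simp add: loop_concat_def)
    next
      case False
      then have "max (1 - 2 * t) (2 * t - 1) = 2 * t - 1" by auto
      with False show ?thesis by (simp add: loop_concat_def)
    qed
  qed
  ultimately show ?thesis using assms by (simp add: o_def loops_def)
qed

lemma reverse_loops: "p \<in> loops X x \<Longrightarrow> (\<lambda>t. p (1 - t)) \<in> loops X x"
proof -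
  assume p: "p \<in> loops X x"
  have "p \<circ> (\<lambda>t. 1 - t) \<in> loops X x"
  proof -
    have "continuous_map (top_of_set {0..1}) (top_of_set {0..1}) (\<lambda>t::real. 1 - t)"
      by (auto intro!: continuous_intros)
    then have "pathin X (p \<circ> (\<lambda>t. 1 - t))"
      using p unfolding loops_def pathin_def by (blast intro: continuous_map_compose)
    then show ?thesis using p by (simp add: loops_def)
  qed
  then show ?thesis by (simp add: o_def)
qed

lemma fundamental_group_mult:
  assumes "p \<in> loops X x" "q \<in> loops X x"
  shows "loop_class X x p \<otimes>\<^bsub>fundamental_group X x\<^esub> loop_class X x q
           = loop_class X x (loop_concat p q)"
proof -
  have *: "loop_class X x (loop_concat p' q') = loop_class X x (loop_concat p q)"
    if "p' \<in> loop_class X x p" "q' \<in> loop_class X x q" for p' q'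
  proof -
    have "loop_homotopic X x (loop_concat p q) (loop_concat p' q')"
      using that unfolding loop_class_def mem_Collect_eq by (rule loop_homotopic_concat)
    then show ?thesis by (rule loop_class_eqI[symmetric])
  qed
  have ne: "loop_class X x p \<noteq> {}" "loop_class X x q \<noteq> {}"
    using loop_class_self[OF assms(1)] loop_class_self[OF assms(2)] by auto
  have "(\<Union>q'\<in>loop_class X x q. loop_class X x (loop_concat p' q')) = loop_class X x (loop_concat p q)"
    if "p' \<in> loop_class X x p" for p'
    by (rule SUP_eq_const[OF ne(2)]) (rule *[OF that])
  then have "(\<Union>p'\<in>loop_class X x p. \<Union>q'\<in>loop_class X x q. loop_class X x (loop_concat p' q'))
      = loop_class X x (loop_concat p q)"
    by (rule SUP_eq_const[OF ne(1)])
  then show ?thesis by (simp add: fundamental_group_def)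
qed

theorem group_fundamental_group:
  assumes "x \<in> topspace X"
  shows "group (fundamental_group X x)"
proof (rule groupI)
  let ?G = "fundamental_group X x"
  have carr: "carrier ?G = loop_class X x ` loops X x"
    and one: "\<one>\<^bsub>?G\<^esub> = loop_class X x (\<lambda>_. x)"
    by (simp_all add: fundamental_group_def)
  show "\<one>\<^bsub>?G\<^esub> \<in> carrier ?G" using assms by (auto simp: carr one const_loops)
  show "A \<otimes>\<^bsub>?G\<^esub> B \<in> carrier ?G" if "A \<in> carrier ?G" "B \<in> carrier ?G" for A B
    using that by (auto simp: carr fundamental_group_mult loop_concat_loops)
  show "A \<otimes>\<^bsub>?G\<^esub> B \<otimes>\<^bsub>?G\<^esub> C = A \<otimes>\<^bsub>?G\<^esub> (B \<otimes>\<^bsub>?G\<^esub> C)"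
    if "A \<in> carrier ?G" "B \<in> carrier ?G" "C \<in> carrier ?G" for A B C
  proof -
    obtain p q r where "p \<in> loops X x" "A = loop_class X x p" "q \<in> loops X x"
      "B = loop_class X x q" "r \<in> loops X x" "C = loop_class X x r"
      using \<open>A \<in> carrier ?G\<close> \<open>B \<in> carrier ?G\<close> \<open>C \<in> carrier ?G\<close> carr by auto
    then show ?thesis
      using loop_class_eqI[OF loop_concat_assoc]
      by (simp add: fundamental_group_mult loop_concat_loops)
  qed
  show "\<one>\<^bsub>?G\<^esub> \<otimes>\<^bsub>?G\<^esub> A = A" if "A \<in> carrier ?G" for A
  proof -
    obtain p where "p \<in> loops X x" "A = loop_class X x p"
      using \<open>A \<in> carrier ?G\<close> carr by auto
    then show ?thesis
      using assms loop_class_eqI[OF loop_concat_const_left]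
      by (simp add: one fundamental_group_mult const_loops)
  qed
  show "\<exists>B\<in>carrier ?G. B \<otimes>\<^bsub>?G\<^esub> A = \<one>\<^bsub>?G\<^esub>" if "A \<in> carrier ?G" for A
  proof -
    obtain p where p: "p \<in> loops X x" "A = loop_class X x p"
      using \<open>A \<in> carrier ?G\<close> carr by auto
    then have "loop_class X x (\<lambda>t. p (1 - t)) \<otimes>\<^bsub>?G\<^esub> A = \<one>\<^bsub>?G\<^esub>"
      using loop_class_eqI[OF loop_concat_reverse]
      by (simp add: fundamental_group_mult reverse_loops one)
    with p show ?thesis by (auto simp: carr reverse_loops)
  qed
qed

lemma loop_homotopic_image:
  assumes "continuous_map X Y f" "loop_homotopic X x p q"
  shows "loop_homotopic Y (f x) (f \<circ> p) (f \<circ> q)"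
  using assms(2) unfolding loop_homotopic_def
  by (rule homotopic_with_compose_continuous_map_left[OF _ assms(1)]) auto

lemma loops_image: "continuous_map X Y f \<Longrightarrow> p \<in> loops X x \<Longrightarrow> f \<circ> p \<in> loops Y (f x)"
  unfolding loops_def pathin_def by (auto intro: continuous_map_compose)

lemma fundamental_group_map_class:
  assumes "continuous_map X Y f" "p \<in> loops X x"
  shows "fundamental_group_map Y f x (loop_class X x p) = loop_class Y (f x) (f \<circ> p)"
proof -
  have *: "loop_class Y (f x) (f \<circ> q) = loop_class Y (f x) (f \<circ> p)" if "q \<in> loop_class X x p" for q
  proof -
    have "loop_homotopic Y (f x) (f \<circ> p) (f \<circ> q)"
      using that unfolding loop_class_def mem_Collect_eq by (rule loop_homotopic_image[OF assms(1)])
    then show ?thesis by (rule loop_class_eqI[symmetric])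
  qed
  have "loop_class X x p \<noteq> {}" using loop_class_self[OF assms(2)] by auto
  then show ?thesis
    unfolding fundamental_group_map_def by (rule SUP_eq_const) (rule *)
qed

theorem fundamental_group_map_hom:
  assumes "continuous_map X Y f"
  shows "fundamental_group_map Y f x \<in> hom (fundamental_group X x) (fundamental_group Y (f x))"
proof (rule homI)
  have carr: "carrier (fundamental_group X x) = loop_class X x ` loops X x"
    "carrier (fundamental_group Y (f x)) = loop_class Y (f x) ` loops Y (f x)"
    by (simp_all add: fundamental_group_def)
  show "fundamental_group_map Y f x A \<in> carrier (fundamental_group Y (f x))"
    if "A \<in> carrier (fundamental_group X x)" for A
  proof -
    obtain p where "p \<in> loops X x" "A = loop_class X x p"
      using \<open>A \<in> carrier (fundamental_group X x)\<close> carr(1) by auto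
    then show ?thesis
      unfolding carr(2) using fundamental_group_map_class[OF assms] loops_image[OF assms] by auto
  qed
  show "fundamental_group_map Y f x (A \<otimes>\<^bsub>fundamental_group X x\<^esub> B) =
      fundamental_group_map Y f x A \<otimes>\<^bsub>fundamental_group Y (f x)\<^esub> fundamental_group_map Y f x B"
    if AB: "A \<in> carrier (fundamental_group X x)" "B \<in> carrier (fundamental_group X x)" for A B
  proof -
    obtain p q where p: "p \<in> loops X x" "A = loop_class X x p"
      and q: "q \<in> loops X x" "B = loop_class X x q"
      using AB carr(1) by auto
    have "f \<circ> loop_concat p q = loop_concat (f \<circ> p) (f \<circ> q)"
      by (auto simp: loop_concat_def)
    then show ?thesis
      unfolding p(2) q(2) fundamental_group_mult[OF p(1) q(1)]
        fundamental_group_map_class[OF assms p(1)] fundamental_group_map_class[OF assms q(1)]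
        fundamental_group_map_class[OF assms loop_concat_loops[OF p(1) q(1)]]
        fundamental_group_mult[OF loops_image[OF assms p(1)] loops_image[OF assms q(1)]]
      by simp
  qed
qed


section \<open>Smooth maps of the circle\<close>

text \<open>
  The circle is \<open>\<real>/\<int>\<close>. Maps from it are 1-periodic functions on \<open>\<real>\<close>; its diffeomorphisms
  are given by their lifts to \<open>\<real>\<close>, which are the diffeomorphisms \<open>\<phi>\<close> of \<open>\<real>\<close> satisfying
  \<open>\<phi> (t + 1) = \<phi> t + 1\<close> for all \<open>t\<close> (orientation preserving) or
  \<open>\<phi> (t + 1) = \<phi> t - 1\<close> for all \<open>t\<close> (orientation reversing).
\<close>

definition nderiv :: "nat \<Rightarrow> (real \<Rightarrow> 'a::real_normed_vector) \<Rightarrow> real \<Rightarrow> 'a"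
  where "nderiv n = ((\<lambda>f t. vector_derivative f (at t)) ^^ n)"

definition smooth :: "(real \<Rightarrow> 'a::real_normed_vector) \<Rightarrow> bool"
  where "smooth f \<longleftrightarrow> (\<forall>n t. nderiv n f differentiable (at t))"

definition smooth_circle_maps :: "(real \<Rightarrow> 'a::real_normed_vector) set"
  where "smooth_circle_maps = {f. smooth f \<and> (\<forall>t. f (t + 1) = f t)}"

definition circle_diffeos :: "(real \<Rightarrow> real) set"
  where "circle_diffeos = {\<phi>. bij \<phi> \<and> smooth \<phi> \<and> smooth (inv_into UNIV \<phi>) \<and>
    ((\<forall>t. \<phi> (t + 1) = \<phi> t + 1) \<or> (\<forall>t. \<phi> (t + 1) = \<phi> t - 1))}"

lemma nderiv_0 [simp]: "nderiv 0 f = f"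
  by (simp add: nderiv_def)

lemma nderiv_Suc: "nderiv (Suc n) f = nderiv n (\<lambda>t. vector_derivative f (at t))"
  unfolding nderiv_def funpow_Suc_right by simp

lemma all_less_Suc_nderiv:
  "(\<forall>m<Suc n. \<forall>t. nderiv m f differentiable (at t)) \<longleftrightarrow>
   (\<forall>t. f differentiable (at t)) \<and>
   (\<forall>m<n. \<forall>t. nderiv m (\<lambda>t. vector_derivative f (at t)) differentiable (at t))"
  by (auto simp: less_Suc_eq_0_disj nderiv_Suc)

lemma smooth_iff_all_less: "smooth f \<longleftrightarrow> (\<forall>n. \<forall>m<n. \<forall>t. nderiv m f differentiable (at t))"
  by (auto simp: smooth_def)

lemma nderiv_add_differentiable:
  fixes f g :: "real \<Rightarrow> 'a::real_normed_vector"
  assumes "\<forall>m<n. \<forall>t. nderiv m f differentiable (at t)" "\<forall>m<n. \<forall>t. nderiv m g differentiable (at t)"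
  shows "\<forall>m<n. \<forall>t. nderiv m (\<lambda>t. f t + g t) differentiable (at t)"
  using assms
proof (induction n arbitrary: f g)
  case (Suc n)
  then have "f differentiable (at t)" "g differentiable (at t)" for t
    unfolding all_less_Suc_nderiv by auto
  then have "(\<lambda>t. vector_derivative (\<lambda>t. f t + g t) (at t)) =
      (\<lambda>t. vector_derivative f (at t) + vector_derivative g (at t))"
    "\<forall>t. (\<lambda>t. f t + g t) differentiable (at t)"
    by (auto simp: fun_eq_iff)
  with Suc show ?case unfolding all_less_Suc_nderiv by simp
qed simp

lemma nderiv_scaleR_differentiable:
  fixes a :: "real \<Rightarrow> real" and f :: "real \<Rightarrow> 'a::real_normed_vector"
  assumes "\<forall>m<n. \<forall>t. nderiv m a differentiable (at t)" "\<forall>m<n. \<forall>t. nderiv m f differentiable (at t)"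
  shows "\<forall>m<n. \<forall>t. nderiv m (\<lambda>t. a t *\<^sub>R f t) differentiable (at t)"
  using assms
proof (induction n arbitrary: a f)
  case (Suc n)
  then have diff: "a differentiable (at t)" "f differentiable (at t)" for t
    unfolding all_less_Suc_nderiv by auto
  have "((\<lambda>t. a t *\<^sub>R f t) has_vector_derivative
      a t *\<^sub>R vector_derivative f (at t) + vector_derivative a (at t) *\<^sub>R f t) (at t)" for t
  proof (rule has_vector_derivative_scaleR)
    show "(a has_field_derivative vector_derivative a (at t)) (at t)"
      using diff(1)[of t] unfolding has_real_derivative_iff_has_vector_derivative
      by (simp add: vector_derivative_works)
    show "(f has_vector_derivative vector_derivative f (at t)) (at t)"
      using diff(2)[of t] by (simp add: vector_derivative_works)
  qed
  then have *: "(\<lambda>t. vector_derivative (\<lambda>t. a t *\<^sub>R f t) (at t)) =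
      (\<lambda>t. a t *\<^sub>R vector_derivative f (at t) + vector_derivative a (at t) *\<^sub>R f t)"
    "\<forall>t. (\<lambda>t. a t *\<^sub>R f t) differentiable (at t)"
    by (auto simp: fun_eq_iff vector_derivative_at dest: differentiableI_vector)
  have low: "\<forall>m<n. \<forall>t. nderiv m a differentiable (at t)" "\<forall>m<n. \<forall>t. nderiv m f differentiable (at t)"
    using Suc.prems by auto
  show ?case
    using Suc.prems low unfolding all_less_Suc_nderiv *(1)
    by (intro conjI *(2) nderiv_add_differentiable Suc.IH) auto
qed simp

lemma nderiv_compose_differentiable:
  fixes \<phi> :: "real \<Rightarrow> real" and f :: "real \<Rightarrow> 'a::real_normed_vector"
  assumes "\<forall>m<n. \<forall>t. nderiv m \<phi> differentiable (at t)" "\<forall>m<n. \<forall>t. nderiv m f differentiable (at t)"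
  shows "\<forall>m<n. \<forall>t. nderiv m (f \<circ> \<phi>) differentiable (at t)"
  using assms
proof (induction n arbitrary: f)
  case (Suc n)
  then have diff: "\<phi> differentiable (at t)" "f differentiable (at t)" for t
    unfolding all_less_Suc_nderiv by auto
  have "((f \<circ> \<phi>) has_vector_derivative
      vector_derivative \<phi> (at t) *\<^sub>R vector_derivative f (at (\<phi> t))) (at t)" for t
    using diff by (intro vector_diff_chain_at) (auto simp: vector_derivative_works)
  then have *: "(\<lambda>t. vector_derivative (f \<circ> \<phi>) (at t)) =
      (\<lambda>t. vector_derivative \<phi> (at t) *\<^sub>R ((\<lambda>t. vector_derivative f (at t)) \<circ> \<phi>) t)"
    "\<forall>t. (f \<circ> \<phi>) differentiable (at t)"
    by (auto simp: fun_eq_iff vector_derivative_at dest: differentiableI_vector)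
  have low: "\<forall>m<n. \<forall>t. nderiv m \<phi> differentiable (at t)" using Suc.prems by auto
  show ?case
    using Suc.prems low unfolding all_less_Suc_nderiv *(1)
    by (intro conjI *(2) nderiv_scaleR_differentiable Suc.IH) auto
qed simp

lemma smooth_compose: "smooth f \<Longrightarrow> smooth \<phi> \<Longrightarrow> smooth (f \<circ> \<phi>)"
  unfolding smooth_iff_all_less by (intro allI nderiv_compose_differentiable) simp_all

lemma smooth_id: "smooth (id :: real \<Rightarrow> real)"
proof -
  have 0: "nderiv n (\<lambda>_. 0 :: real) = (\<lambda>_. 0)" for n
    by (induction n) (simp_all add: nderiv_Suc)
  have 1: "nderiv n (\<lambda>_. 1 :: real) differentiable (at t)" for n t
    by (cases n) (simp_all add: nderiv_Suc 0)
  show ?thesis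
    unfolding smooth_def
  proof (intro allI)
    fix n and t :: real
    show "nderiv n id differentiable (at t)"
    proof (cases n)
      case (Suc m)
      have "(\<lambda>t. vector_derivative id (at t)) = (\<lambda>_. 1 :: real)"
        unfolding id_def by simp
      then show ?thesis unfolding Suc nderiv_Suc by (simp add: 1)
    qed (simp add: id_def)
  qed
qed

lemma id_circle_diffeos: "id \<in> circle_diffeos"
  by (simp add: circle_diffeos_def smooth_id inv_id)

lemma circle_diffeos_comp:
  assumes "\<phi> \<in> circle_diffeos" "\<psi> \<in> circle_diffeos"
  shows "\<phi> \<circ> \<psi> \<in> circle_diffeos"
proof -
  have b: "bij \<phi>" "bij \<psi>" and s: "smooth \<phi>" "smooth \<psi>"
      "smooth (inv_into UNIV \<phi>)" "smooth (inv_into UNIV \<psi>)"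
    and \<phi>: "(\<forall>t. \<phi> (t + 1) = \<phi> t + 1) \<or> (\<forall>t. \<phi> (t + 1) = \<phi> t - 1)"
    and \<psi>: "(\<forall>t. \<psi> (t + 1) = \<psi> t + 1) \<or> (\<forall>t. \<psi> (t + 1) = \<psi> t - 1)"
    using assms unfolding circle_diffeos_def by blast+
  have inv: "inv_into UNIV (\<phi> \<circ> \<psi>) = inv_into UNIV \<psi> \<circ> inv_into UNIV \<phi>"
    using b by (rule o_inv_distrib)
  have "(\<forall>t. \<phi> (\<psi> (t + 1)) = \<phi> (\<psi> t) + 1) \<or> (\<forall>t. \<phi> (\<psi> (t + 1)) = \<phi> (\<psi> t) - 1)"
    using \<psi>
  proof
    assume "\<forall>t. \<psi> (t + 1) = \<psi> t + 1"
    then show ?thesis using \<phi> by metis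
  next
    assume "\<forall>t. \<psi> (t + 1) = \<psi> t - 1"
    moreover have "(\<forall>t. \<phi> (t - 1) = \<phi> t - 1) \<or> (\<forall>t. \<phi> (t - 1) = \<phi> t + 1)"
      using \<phi> by (metis add_diff_cancel_right' diff_add_cancel)
    ultimately show ?thesis by metis
  qed
  then show ?thesis
    unfolding circle_diffeos_def using b s inv by (simp add: bij_comp smooth_compose)
qed

lemma circle_diffeos_inv:
  assumes "\<phi> \<in> circle_diffeos"
  shows "inv_into UNIV \<phi> \<in> circle_diffeos"
proof -
  let ?i = "inv_into UNIV \<phi>"
  have b: "bij \<phi>" using assms by (simp add: circle_diffeos_def)
  have i: "\<phi> (?i t) = t" "?i (\<phi> t) = t" for t
    using b by (simp_all add: bij_is_surj surj_f_inv_f bij_is_inj inv_f_f)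
  have "?i (t + 1) = ?i t + 1" if "\<forall>t. \<phi> (t + 1) = \<phi> t + 1" for t
  proof -
    have "\<phi> (?i t + 1) = t + 1" using that[rule_format, of "?i t"] i(1)[of t] by simp
    then show ?thesis using i(2)[of "?i t + 1"] by simp
  qed
  moreover have "?i (t + 1) = ?i t - 1" if *: "\<forall>t. \<phi> (t + 1) = \<phi> t - 1" for t
  proof -
    have "\<phi> (?i t - 1) = t + 1" using *[rule_format, of "?i t - 1"] i(1)[of t] by simp
    then show ?thesis using i(2)[of "?i t - 1"] by simp
  qed
  moreover have "smooth \<phi>" "smooth ?i"
    "(\<forall>t. \<phi> (t + 1) = \<phi> t + 1) \<or> (\<forall>t. \<phi> (t + 1) = \<phi> t - 1)"
    using assms unfolding circle_diffeos_def by blast+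
  ultimately have "(\<forall>t. ?i (t + 1) = ?i t + 1) \<or> (\<forall>t. ?i (t + 1) = ?i t - 1)" by blast
  with b \<open>smooth \<phi>\<close> \<open>smooth ?i\<close> show ?thesis
    unfolding circle_diffeos_def by (simp add: bij_imp_bij_inv inv_inv_eq)
qed

text \<open>
  The \<open>C\<^sup>\<infinity>\<close> topology: uniform convergence of all derivatives. The pointwise strict bound
  in \<open>Cinf_nbhd\<close> is a bound on the sup norm, since the supremum of a continuous periodic
  function is attained.
\<close>

definition Cinf_nbhd :: "(real \<Rightarrow> 'a::real_normed_vector) \<Rightarrow> nat \<Rightarrow> real \<Rightarrow> (real \<Rightarrow> 'a) set"
  where "Cinf_nbhd f n e = {g \<in> smooth_circle_maps. \<forall>t. norm (nderiv n g t - nderiv n f t) < e}"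

definition Cinf_topology :: "(real \<Rightarrow> 'a::real_normed_vector) topology"
  where "Cinf_topology =
    topology_generated_by {Cinf_nbhd f n e | f n e. f \<in> smooth_circle_maps \<and> e > 0}"

lemma topspace_Cinf_topology [simp]: "topspace Cinf_topology = smooth_circle_maps"
proof -
  have "f \<in> \<Union>{Cinf_nbhd f n e | f n e. f \<in> smooth_circle_maps \<and> e > 0}"
    if f: "f \<in> smooth_circle_maps" for f :: "real \<Rightarrow> 'a"
  proof (rule UnionI)
    show "Cinf_nbhd f 0 1 \<in> {Cinf_nbhd f n e | f n e. f \<in> smooth_circle_maps \<and> e > 0}"
      using f zero_less_one by blast
    show "f \<in> Cinf_nbhd f 0 1" using f by (simp add: Cinf_nbhd_def)
  qed
  moreover have "\<Union>{Cinf_nbhd f n e | f n e. f \<in> smooth_circle_maps \<and> e > 0}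
      \<subseteq> (smooth_circle_maps :: (real \<Rightarrow> 'a) set)"
    unfolding Cinf_nbhd_def by blast
  ultimately show ?thesis
    unfolding Cinf_topology_def topology_generated_by_topspace by blast
qed


section \<open>Spaces of knots\<close>

definition knot_embeddings :: "(real \<Rightarrow> real^3) set"
  where "knot_embeddings = {f \<in> smooth_circle_maps.
    (\<forall>s t. f s = f t \<longrightarrow> s - t \<in> \<int>) \<and> (\<forall>t. vector_derivative f (at t) \<noteq> 0)}"

text \<open>\<open>\<alpha> = dz - y dx\<close>, evaluated at the point \<open>p\<close> on the tangent vector \<open>v\<close>.\<close>

definition contact_form :: "real^3 \<Rightarrow> real^3 \<Rightarrow> real"
  where "contact_form p v = v $ 3 - p $ 2 * v $ 1"

definition legendrian_embeddings :: "(real \<Rightarrow> real^3) set"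
  where "legendrian_embeddings =
    {f \<in> knot_embeddings. \<forall>t. contact_form (f t) (vector_derivative f (at t)) = 0}"

text \<open>
  Knots are unparametrized and unoriented: all diffeomorphisms of the circle are divided out.
\<close>

definition knot_class :: "(real \<Rightarrow> 'a) \<Rightarrow> (real \<Rightarrow> 'a) set"
  where "knot_class f = {f \<circ> \<phi> | \<phi>. \<phi> \<in> circle_diffeos}"

definition Emb_space :: "(real \<Rightarrow> real^3) set topology"
  where "Emb_space = quotient_topology (subtopology Cinf_topology knot_embeddings) knot_class"

text \<open>
  Points of \<open>Leg_space\<close> are literally points of \<open>Emb_space\<close>: a reparametrization of a
  Legendrian embedding is Legendrian. So the inclusion is the identity function.
\<close>

definition Leg_space :: "(real \<Rightarrow> real^3) set topology"
  where "Leg_space = quotient_topology (subtopology Cinf_topology legendrian_embeddings) knot_class"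

definition smooth_knot_types :: "(real \<Rightarrow> real^3) set set set"
  where "smooth_knot_types = connected_components_of Emb_space"

definition legendrian_knot_types :: "(real \<Rightarrow> real^3) set set set"
  where "legendrian_knot_types = connected_components_of Leg_space"

lemma knot_classI: "\<phi> \<in> circle_diffeos \<Longrightarrow> f \<circ> \<phi> \<in> knot_class f"
  unfolding knot_class_def by blast

lemma knot_classE:
  assumes "h \<in> knot_class f"
  obtains \<phi> where "\<phi> \<in> circle_diffeos" "h = f \<circ> \<phi>"
  using assms unfolding knot_class_def by blast

lemma knot_class_subset:
  assumes "\<phi> \<in> circle_diffeos"
  shows "knot_class (f \<circ> \<phi>) \<subseteq> knot_class f"
proof
  fix h assume "h \<in> knot_class (f \<circ> \<phi>)"
  then obtain \<psi> where "\<psi> \<in> circle_diffeos" "h = f \<circ> \<phi> \<circ> \<psi>" by (rule knot_classE)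
  then show "h \<in> knot_class f"
    using knot_classI[OF circle_diffeos_comp[OF assms], of \<psi> f] by (metis o_assoc)
qed

lemma knot_class_eq_iff: "knot_class f = knot_class g \<longleftrightarrow> (\<exists>\<phi>\<in>circle_diffeos. g = f \<circ> \<phi>)"
proof
  assume "knot_class f = knot_class g"
  then have "g \<in> knot_class f" using knot_classI[OF id_circle_diffeos, of g] by (metis comp_id)
  then show "\<exists>\<phi>\<in>circle_diffeos. g = f \<circ> \<phi>" by (metis knot_classE)
next
  assume "\<exists>\<phi>\<in>circle_diffeos. g = f \<circ> \<phi>"
  then obtain \<phi> where \<phi>: "\<phi> \<in> circle_diffeos" "g = f \<circ> \<phi>" by blast
  then have "surj \<phi>" by (simp add: circle_diffeos_def bij_is_surj)
  then have "f = g \<circ> inv_into UNIV \<phi>"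
    unfolding \<phi>(2) by (simp add: fun_eq_iff surj_f_inv_f)
  then have "knot_class f \<subseteq> knot_class g"
    using knot_class_subset[OF circle_diffeos_inv[OF \<phi>(1)], of g] by metis
  moreover have "knot_class g \<subseteq> knot_class f"
    unfolding \<phi>(2) by (rule knot_class_subset[OF \<phi>(1)])
  ultimately show "knot_class f = knot_class g" by blast
qed

lemma topspace_Emb_space: "topspace Emb_space = knot_class ` knot_embeddings"
proof -
  have "knot_embeddings \<subseteq> smooth_circle_maps" by (auto simp: knot_embeddings_def)
  then show ?thesis by (simp add: Emb_space_def Int_absorb1)
qed

lemma topspace_Leg_space: "topspace Leg_space = knot_class ` legendrian_embeddings"
proof -
  have "legendrian_embeddings \<subseteq> smooth_circle_maps"
    by (auto simp: legendrian_embeddings_def knot_embeddings_def)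
  then show ?thesis by (simp add: Leg_space_def Int_absorb1)
qed

lemma continuous_map_Leg_Emb: "continuous_map Leg_space Emb_space id"
proof -
  have sub: "legendrian_embeddings \<subseteq> knot_embeddings" by (auto simp: legendrian_embeddings_def)
  have "continuous_map (subtopology Cinf_topology legendrian_embeddings) Emb_space knot_class"
    using quotient_imp_continuous_map[OF quotient_map_quotient_topology] sub
    unfolding Emb_space_def by (rule continuous_map_from_subtopology_mono)
  then have "continuous_map (subtopology Cinf_topology legendrian_embeddings) Emb_space (id \<circ> knot_class)"
    by simp
  then show ?thesis
    unfolding Leg_space_def
    using continuous_compose_quotient_map[OF quotient_map_quotient_topology] by blast
qed

lemma continuous_map_knot_type_inclusion:
  assumes "\<L> \<subseteq> \<K>"
  shows "continuous_map (subtopology Leg_space \<L>) (subtopology Emb_space \<K>) id"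
  using assms continuous_map_Leg_Emb
  by (auto simp: continuous_map_in_subtopology intro: continuous_map_from_subtopology)

end

theory Submission
  imports Defs
begin

text \<open>
  Rotations of the \<open>(x, y)\<close>-plane lift to contactomorphisms of \<open>\<real>\<^sup>3\<close>: in the coordinate
  \<open>w = z - x y / 2\<close> the contact form is \<open>dw + (x dy - y dx) / 2\<close>, which is invariant under
  rotations about the \<open>w\<close>-axis. Turning a Legendrian knot twice around that axis gives a loop
  of Legendrian knots. As a loop of smooth knots it is null-homotopic, because the double turn
  is null-homotopic in \<open>SO(3)\<close>.

  If the Legendrian knot has rotation number 0, the loop is essential among Legendrian
  knots. The projection of the velocity to the \<open>(x, y)\<close>-plane never vanishes, and the square of
  its direction, which does not see orientations, has a continuous periodic argument
  \<open>\<theta>\<close>, well defined modulo \<open>2 \<pi>\<close>. So \<open>exp (\<i> sup \<theta>)\<close> is a continuous function of the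
  unparametrized knot, and it winds four times around the circle along the loop.
\<close>

section \<open>Smooth functions and the smooth topology\<close>

lemma smooth_add:
  assumes "smooth f" "smooth g" shows "smooth (\<lambda>t. f t + g t)"
proof -
  have "\<forall>m<n. \<forall>t. nderiv m (\<lambda>t. f t + g t) differentiable (at t)" for n
    by (rule nderiv_add_differentiable) (use assms in \<open>auto simp: smooth_def\<close>)
  then show ?thesis unfolding smooth_iff_all_less by blast
qed

lemma smooth_scaleR:
  fixes a :: "real \<Rightarrow> real"
  assumes "smooth a" "smooth f" shows "smooth (\<lambda>t. a t *\<^sub>R f t)"
proof -
  have "\<forall>m<n. \<forall>t. nderiv m (\<lambda>t. a t *\<^sub>R f t) differentiable (at t)" for n
    by (rule nderiv_scaleR_differentiable) (use assms in \<open>auto simp: smooth_def\<close>)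
  then show ?thesis unfolding smooth_iff_all_less by blast
qed

lemma smooth_mult:
  fixes f g :: "real \<Rightarrow> real"
  shows "smooth f \<Longrightarrow> smooth g \<Longrightarrow> smooth (\<lambda>t. f t * g t)"
  using smooth_scaleR[of f g] by simp

lemma smooth_const: "smooth (\<lambda>_. c)"
proof -
  have "nderiv n (\<lambda>_. 0) = (\<lambda>_::real. 0::'a)" for n
    by (induction n) (simp_all add: nderiv_Suc)
  then have "nderiv n (\<lambda>_. c) differentiable (at t)" for n t
    by (cases n) (simp_all add: nderiv_Suc)
  then show ?thesis by (simp add: smooth_def)
qed

lemma smooth_deriv: "smooth f \<Longrightarrow> smooth (\<lambda>t. vector_derivative f (at t))"
  unfolding smooth_def by (metis nderiv_Suc)

lemma smooth_has_vector_derivative: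
  "smooth f \<Longrightarrow> (f has_vector_derivative vector_derivative f (at t)) (at t)"
  unfolding smooth_def by (metis nderiv_0 vector_derivative_works)

lemma smooth_nderiv: "smooth f \<Longrightarrow> smooth (nderiv n f)"
  by (induction n arbitrary: f) (simp_all add: nderiv_Suc smooth_deriv)

lemma smooth_continuous_on: "smooth f \<Longrightarrow> continuous_on S f"
  by (meson continuous_at_imp_continuous_on has_vector_derivative_continuous
      smooth_has_vector_derivative)

lemma nderiv_linear:
  assumes "bounded_linear L" "smooth f"
  shows "nderiv n (\<lambda>t. L (f t)) = (\<lambda>t. L (nderiv n f t))"
  using assms(2)
proof (induction n arbitrary: f)
  case (Suc n)
  have "(\<lambda>t. vector_derivative (\<lambda>t. L (f t)) (at t)) = (\<lambda>t. L (vector_derivative f (at t)))"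
    using bounded_linear.has_vector_derivative[OF assms(1) smooth_has_vector_derivative[OF Suc.prems]]
    by (auto simp: fun_eq_iff vector_derivative_at)
  then show ?case
    using Suc.IH[OF smooth_deriv[OF Suc.prems]] by (simp add: nderiv_Suc)
qed simp

lemma smooth_linear:
  assumes "bounded_linear L" "smooth f" shows "smooth (\<lambda>t. L (f t))"
  unfolding smooth_def nderiv_linear[OF assms]
  using bounded_linear.has_vector_derivative[OF assms(1) smooth_has_vector_derivative[OF smooth_nderiv[OF assms(2)]]]
  by (blast intro: differentiableI_vector)

lemma smooth_nth: "smooth f \<Longrightarrow> smooth (\<lambda>t. f t $ i)" for f :: "real \<Rightarrow> real^'n"
  by (rule smooth_linear[OF bounded_linear_vec_nth])

lemma nderiv_add:
  assumes "smooth f" "smooth g"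
  shows "nderiv n (\<lambda>t. f t + g t) = (\<lambda>t. nderiv n f t + nderiv n g t)"
  using assms
proof (induction n arbitrary: f g)
  case (Suc n)
  have "(\<lambda>t. vector_derivative (\<lambda>t. f t + g t) (at t)) =
      (\<lambda>t. vector_derivative f (at t) + vector_derivative g (at t))"
    using has_vector_derivative_add[OF smooth_has_vector_derivative[OF Suc.prems(1)]
        smooth_has_vector_derivative[OF Suc.prems(2)]]
    by (auto simp: fun_eq_iff vector_derivative_at)
  then show ?case
    using Suc.IH[OF smooth_deriv[OF Suc.prems(1)] smooth_deriv[OF Suc.prems(2)]]
    by (simp add: nderiv_Suc)
qed simp

lemma smooth_sum_scaleR:
  assumes "finite I" "\<And>i. i \<in> I \<Longrightarrow> smooth (g i)"
  shows "smooth (\<lambda>t. \<Sum>i\<in>I. c i *\<^sub>R g i t)"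
  using assms by (induction I) (auto intro!: smooth_const smooth_add smooth_scaleR)

lemma nderiv_sum_scaleR:
  assumes "finite I" "\<And>i. i \<in> I \<Longrightarrow> smooth (g i)"
  shows "nderiv n (\<lambda>t. \<Sum>i\<in>I. c i *\<^sub>R g i t) = (\<lambda>t. \<Sum>i\<in>I. c i *\<^sub>R nderiv n (g i) t)"
  using assms
proof (induction I)
  case empty
  show ?case by (induction n) (simp_all add: nderiv_Suc)
next
  case (insert j I)
  have "nderiv n (\<lambda>t. c j *\<^sub>R g j t) = (\<lambda>t. c j *\<^sub>R nderiv n (g j) t)"
    by (rule nderiv_linear[OF bounded_linear_scaleR_right]) (simp add: insert)
  with insert show ?case
    by (simp add: nderiv_add smooth_sum_scaleR smooth_scaleR smooth_const)
qed

text \<open>Differentiation multiplies the amplitude by \<open>a\<close> and shifts the phase by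
  \<pi>/2, so the induction runs over all amplitudes \<open>c\<close> and phases
  \<open>b\<close>.\<close>

lemma smooth_cos_affine: "smooth (\<lambda>t. cos (a * t + b))" for a b :: real
proof -
  have "nderiv n (\<lambda>t. c * cos (a * t + b)) differentiable (at t)" for n and b c t :: real
  proof (induction n arbitrary: b c t)
    case (Suc n)
    have "((\<lambda>t. c * cos (a * t + b)) has_vector_derivative c * a * cos (a * t + (b + pi/2))) (at t)" for t
      unfolding has_real_derivative_iff_has_vector_derivative[symmetric]
      by (auto intro!: derivative_eq_intros simp: minus_sin_cos_eq[of "a * t + b" for t, simplified, symmetric] add.assoc[symmetric])
    then have "(\<lambda>t. vector_derivative (\<lambda>t. c * cos (a * t + b)) (at t)) =
        (\<lambda>t. c * a * cos (a * t + (b + pi/2)))"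
      by (auto simp: fun_eq_iff vector_derivative_at)
    then show ?case using Suc by (simp add: nderiv_Suc)
  next
    case 0
    have "((\<lambda>t. c * cos (a * t + b)) has_real_derivative - (c * (sin (a * t + b) * a))) (at t)"
      by (auto intro!: derivative_eq_intros)
    then show ?case by (auto simp: real_differentiable_def)
  qed
  from this[where c = 1] show ?thesis by (simp add: smooth_def)
qed

section \<open>Periodic functions\<close>

lemma smooth_circle_maps_periodic:
  assumes "f \<in> smooth_circle_maps" shows "nderiv n f (t + 1) = nderiv n f t"
proof -
  have "smooth f" "\<forall>t. f (t + 1) = f t"
    using assms by (auto simp: smooth_circle_maps_def)
  then have "\<forall>t. nderiv n f (t + 1) = nderiv n f t"
  proof (induction n arbitrary: f)
    case (Suc n)
    have "vector_derivative f (at (t + 1)) = vector_derivative f (at t)" for t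
    proof -
      have "((f \<circ> (\<lambda>t. t + 1)) has_vector_derivative 1 *\<^sub>R vector_derivative f (at (t + 1))) (at t)"
        by (rule vector_diff_chain_at)
           (auto intro!: derivative_eq_intros smooth_has_vector_derivative Suc.prems(1))
      moreover have "f \<circ> (\<lambda>t. t + 1) = f" using Suc.prems(2) by auto
      ultimately show ?thesis by (simp add: vector_derivative_at)
    qed
    then show ?case
      using Suc.IH[OF smooth_deriv[OF Suc.prems(1)]] by (simp add: nderiv_Suc)
  qed simp
  then show ?thesis by blast
qed

lemma periodic_diff_Ints:
  assumes "\<And>t::real. h (t + 1) = h t" "s - t \<in> \<int>" shows "h s = h t"
proof -
  interpret periodic_fun_simple' h by unfold_locales (rule assms)
  obtain k where "s = t + of_int k" using assms(2) by (auto elim!: Ints_cases simp: algebra_simps)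
  then show ?thesis using plus_of_int[of t k] by simp
qed

lemma periodic_range:
  assumes "\<And>t::real. h (t + 1) = h t" shows "h ` {0..1} = range h"
proof -
  have "h t \<in> h ` {0..1}" for t
    using periodic_diff_Ints[of h t "frac t"] assms frac_lt_1[of t]
    by (auto simp: frac_def intro!: image_eqI[of _ h "frac t"])
  then show ?thesis by auto
qed

text \<open>One period is compact. This turns pointwise strict bounds into uniform margins and
  provides maximum points of phase lifts.\<close>

lemma periodic_attains_sup:
  fixes h :: "real \<Rightarrow> real"
  assumes "continuous_on UNIV h" "\<And>t. h (t + 1) = h t"
  obtains s where "\<And>t. h t \<le> h s"
proof -
  have "continuous_on {0..1} h" using assms(1) continuous_on_subset by blast
  then obtain s where "\<forall>t\<in>{0..1}. h t \<le> h s"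
    using continuous_attains_sup[of "{0..1}" h] by auto
  then have "h t \<le> h s" for t
    using periodic_range[of h] assms(2) by (metis image_iff rangeI)
  then show thesis by (rule that)
qed

lemma smooth_circle_maps_bounded:
  assumes "f \<in> smooth_circle_maps"
  obtains C where "\<And>t. norm (nderiv n f t) \<le> C"
proof -
  have "smooth f" using assms by (simp add: smooth_circle_maps_def)
  then have "continuous_on UNIV (\<lambda>t. norm (nderiv n f t))"
    by (intro continuous_on_norm smooth_continuous_on smooth_nderiv)
  moreover have "norm (nderiv n f (t + 1)) = norm (nderiv n f t)" for t
    by (simp add: smooth_circle_maps_periodic[OF assms])
  ultimately show thesis
    using periodic_attains_sup[of "\<lambda>t. norm (nderiv n f t)"] that by metis
qed

section \<open>Continuous families in the smooth topology\<close>

lemma openin_Cinf_nbhd: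
  assumes "f \<in> smooth_circle_maps" "e > 0"
  shows "openin Cinf_topology (Cinf_nbhd f n e)"
  unfolding Cinf_topology_def
  by (rule topology_generated_by_Basis) (use assms in blast)

lemma sum_scaleR_smooth_circle_maps:
  assumes "finite I" "\<And>i. i \<in> I \<Longrightarrow> g i \<in> smooth_circle_maps"
  shows "(\<lambda>t. \<Sum>i\<in>I. c i *\<^sub>R g i t) \<in> smooth_circle_maps"
  using assms by (auto simp: smooth_circle_maps_def intro!: smooth_sum_scaleR sum.cong)

text \<open>Only the coefficients vary with the parameter, so derivatives of two members differ by a
  combination of the bounded functions \<open>nderiv n (g i)\<close>. Testing generating
  neighbourhoods suffices.\<close>

lemma continuous_map_Cinf_sum:
  fixes g :: "'i \<Rightarrow> real \<Rightarrow> 'a::real_normed_vector"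
  assumes I: "finite I" and g: "\<And>i. i \<in> I \<Longrightarrow> g i \<in> smooth_circle_maps"
    and c: "\<And>i. i \<in> I \<Longrightarrow> continuous_map X euclideanreal (c i)"
  shows "continuous_map X Cinf_topology (\<lambda>z t. \<Sum>i\<in>I. c i z *\<^sub>R g i t)"
  unfolding Cinf_topology_def
proof (rule continuous_on_generated_topo)
  let ?F = "\<lambda>z t. \<Sum>i\<in>I. c i z *\<^sub>R g i t"
  show "?F ` topspace X \<subseteq> \<Union>{Cinf_nbhd f n e |f n e. f \<in> smooth_circle_maps \<and> e > 0}"
  proof -
    have "\<Union>{Cinf_nbhd f n e |f n e. f \<in> smooth_circle_maps \<and> e > 0} = (smooth_circle_maps :: (real \<Rightarrow> 'a) set)"
      using topspace_Cinf_topology unfolding Cinf_topology_def topology_generated_by_topspace .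
    then show ?thesis
      by (simp only:) (intro image_subsetI sum_scaleR_smooth_circle_maps I g)
  qed
  have sm: "smooth (g i)" if "i \<in> I" for i using g[OF that] by (simp add: smooth_circle_maps_def)
  fix U :: "(real \<Rightarrow> 'a) set"
  assume "U \<in> {Cinf_nbhd f n e |f n e. f \<in> smooth_circle_maps \<and> e > 0}"
  then obtain f n e where U: "U = Cinf_nbhd f n e" and f: "f \<in> smooth_circle_maps" "e > 0" by blast
  have "\<exists>V. openin X V \<and> z \<in> V \<and> V \<subseteq> ?F -` U \<inter> topspace X" if z: "z \<in> ?F -` U \<inter> topspace X" for z
  proof -
    \<comment> \<open>\<open>h\<close> attains its maximum, so membership in \<open>U\<close> leaves
      the positive margin \<open>e - h s\<close>, to be compared with the change \<open>d\<close> of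
      the derivative.\<close>
    define h where "h = (\<lambda>t. norm (nderiv n (?F z) t - nderiv n f t))"
    have Fz: "?F z \<in> smooth_circle_maps" by (rule sum_scaleR_smooth_circle_maps[OF I g])
    have "continuous_on UNIV h"
      unfolding h_def using Fz f
      by (intro continuous_intros smooth_continuous_on smooth_nderiv) (auto simp: smooth_circle_maps_def)
    moreover have "h (t + 1) = h t" for t
      unfolding h_def by (simp only: smooth_circle_maps_periodic[OF Fz] smooth_circle_maps_periodic[OF f(1)])
    ultimately obtain s where s: "\<And>t. h t \<le> h s" using periodic_attains_sup by blast
    have "h s < e" using z by (simp add: U Cinf_nbhd_def h_def)
    have "\<exists>C. \<forall>t. norm (nderiv n (g i) t) \<le> C" if "i \<in> I" for i
      using smooth_circle_maps_bounded[OF g[OF that], of n] by blast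
    then obtain C where C: "\<And>i t. i \<in> I \<Longrightarrow> norm (nderiv n (g i) t) \<le> C i"
      by metis
    define d where "d = (\<lambda>w. \<Sum>i\<in>I. \<bar>c i w - c i z\<bar> * C i)"
    have "continuous_map X euclideanreal d"
      unfolding d_def by (intro continuous_map_sum I continuous_map_real_mult continuous_map_real_abs
          continuous_map_diff c) auto
    then have "openin X {w \<in> topspace X. d w \<in> {..<e - h s}}"
      by (rule openin_continuous_map_preimage) simp
    moreover have "z \<in> {w \<in> topspace X. d w \<in> {..<e - h s}}"
      using z \<open>h s < e\<close> by (simp add: d_def)
    moreover have "?F w \<in> U" if "d w < e - h s" for w
    proof -
      have "norm (nderiv n (?F w) t - nderiv n f t) < e" for t
      proof -
        have "nderiv n (?F w) t - nderiv n (?F z) t = (\<Sum>i\<in>I. (c i w - c i z) *\<^sub>R nderiv n (g i) t)"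
          by (simp add: nderiv_sum_scaleR[OF I sm] scaleR_diff_left sum_subtractf)
        also have "norm \<dots> \<le> d w"
          unfolding d_def by (rule sum_norm_le) (simp add: C mult_left_mono)
        finally have "norm (nderiv n (?F w) t - nderiv n (?F z) t) \<le> d w" .
        then show ?thesis
          using norm_triangle_ineq[of "nderiv n (?F w) t - nderiv n (?F z) t" "nderiv n (?F z) t - nderiv n f t"]
            s[of t] that by (simp add: h_def)
      qed
      then show ?thesis using sum_scaleR_smooth_circle_maps[OF I g] by (simp add: U Cinf_nbhd_def)
    qed
    ultimately show ?thesis
      by (intro exI[of _ "{w \<in> topspace X. d w \<in> {..<e - h s}}"]) auto
  qed
  then show "openin X (?F -` U \<inter> topspace X)"
    by (subst openin_subopen) blast
qed

section \<open>Rotations in sheared coordinates\<close>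

text \<open>\<open>c = -1/2\<close> passes from z to the coordinate w = z - x y / 2, and
  \<open>c = 1/2\<close> passes back.\<close>

definition shear :: "real \<Rightarrow> real^3 \<Rightarrow> real^3"
  where "shear c p = p + (c * p $ 1 * p $ 2) *\<^sub>R axis 3 1"

text \<open>The linear map \<open>B\<close> in the coordinates (x, y, w), transported to (x, y, z);
  matrix products then act as compositions.\<close>

definition sheared :: "real^3^3 \<Rightarrow> (real \<Rightarrow> real^3) \<Rightarrow> real \<Rightarrow> real^3"
  where "sheared B f t = shear (1/2) (B *v shear (-1/2) (f t))"

lemma shear_nth: "shear c p $ 1 = p $ 1" "shear c p $ 2 = p $ 2" "shear c p $ 3 = p $ 3 + c * p $ 1 * p $ 2"
  by (simp_all add: shear_def axis_def)

lemma shear_shear: "shear c (shear d p) = shear (c + d) p"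
  by (simp add: vec_eq_iff forall_3 shear_nth algebra_simps)

lemma shear_0: "shear 0 p = p"
  by (simp add: shear_def)

lemma sheared_sheared: "sheared A (sheared B f) = sheared (A ** B) f"
  by (simp add: fun_eq_iff sheared_def shear_shear shear_0 matrix_vector_mul_assoc)

lemma sheared_mat_1: "sheared (mat 1) f = f"
  by (simp add: fun_eq_iff sheared_def shear_shear shear_0)

lemma smooth_circle_maps_shear:
  assumes "f \<in> smooth_circle_maps" shows "(\<lambda>t. shear c (f t)) \<in> smooth_circle_maps"
  using assms by (auto simp: smooth_circle_maps_def shear_def
      intro!: smooth_add smooth_scaleR smooth_mult smooth_const smooth_nth)

text \<open>
  The coefficients depend only on \<open>B\<close> and the summands only on \<open>f\<close>, as needed for
  \<^term>\<open>continuous_map\<close> into the \<open>C\<^sup>\<infinity>\<close> topology.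
\<close>

lemma sheared_eq_sum:
  "sheared B f = (\<lambda>t. \<Sum>i\<in>UNIV. (case i of Inl (i, j) \<Rightarrow> B $ i $ j | Inr (j, k) \<Rightarrow> B $ 1 $ j * B $ 2 $ k) *\<^sub>R
     (case i of Inl (i, j) \<Rightarrow> (shear (-1/2) (f t) $ j) *\<^sub>R axis i 1
       | Inr (j, k) \<Rightarrow> (1/2 * shear (-1/2) (f t) $ j * shear (-1/2) (f t) $ k) *\<^sub>R axis 3 1))"
proof
  fix t
  \<comment> \<open>The \<open>Inl\<close> terms are the entries of \<open>B *v u\<close>; the
    \<open>Inr\<close> terms expand the shear correction, half the product of its first two
    entries.\<close>
  define u where "u = shear (-1/2) (f t)"
  show "sheared B f t = (\<Sum>i\<in>UNIV. (case i of Inl (i, j) \<Rightarrow> B $ i $ j | Inr (j, k) \<Rightarrow> B $ 1 $ j * B $ 2 $ k) *\<^sub>R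
     (case i of Inl (i, j) \<Rightarrow> (shear (-1/2) (f t) $ j) *\<^sub>R axis i 1
       | Inr (j, k) \<Rightarrow> (1/2 * shear (-1/2) (f t) $ j * shear (-1/2) (f t) $ k) *\<^sub>R axis 3 1))"
    unfolding sheared_def u_def[symmetric] shear_def[of "1/2"]
    by (simp only: UNIV_Plus_UNIV[symmetric] sum.Plus[OF finite finite] UNIV_Times_UNIV[symmetric]
        sum.cartesian_product' o_def old.sum.case prod.case sum_3)
       (simp add: vec_eq_iff forall_3 axis_def matrix_vector_mult_def sum_3 field_simps)
qed

lemma sheared_summand:
  assumes "u \<in> smooth_circle_maps"
  shows "(\<lambda>t. case i of Inl (i, j) \<Rightarrow> (u t $ j) *\<^sub>R axis i 1
       | Inr (j, k) \<Rightarrow> (1/2 * u t $ j * u t $ k) *\<^sub>R (axis 3 1 :: real^3)) \<in> smooth_circle_maps"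
proof -
  have u: "smooth u" "\<And>t. u (t + 1) = u t" using assms by (auto simp: smooth_circle_maps_def)
  consider j k where "i = Inl (j, k)" | j k where "i = Inr (j, k)"
    by (metis sum.exhaust prod.exhaust)
  then show ?thesis
    by cases (auto simp only: smooth_circle_maps_def mem_Collect_eq sum.case prod.case u
      intro!: smooth_scaleR smooth_mult smooth_const smooth_nth u)
qed

lemma smooth_circle_maps_sheared:
  assumes "f \<in> smooth_circle_maps" shows "sheared B f \<in> smooth_circle_maps"
  unfolding sheared_eq_sum by (intro sum_scaleR_smooth_circle_maps sheared_summand[OF smooth_circle_maps_shear[OF assms]]) simp

lemma continuous_map_sheared:
  assumes "f \<in> smooth_circle_maps"
    and "\<And>i j. continuous_map X euclideanreal (\<lambda>z. B z $ i $ j)"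
  shows "continuous_map X Cinf_topology (\<lambda>z. sheared (B z) f)"
  unfolding sheared_eq_sum
proof (intro continuous_map_Cinf_sum sheared_summand[OF smooth_circle_maps_shear[OF assms(1)]])
  fix i :: "(3 \<times> 3) + (3 \<times> 3)"
  show "continuous_map X euclideanreal
      (\<lambda>z. case i of Inl (i, j) \<Rightarrow> B z $ i $ j | Inr (j, k) \<Rightarrow> B z $ 1 $ j * B z $ 2 $ k)"
  proof -
    consider j k where "i = Inl (j, k)" | j k where "i = Inr (j, k)"
      by (metis sum.exhaust prod.exhaust)
    then show ?thesis by cases (simp_all add: assms(2) continuous_map_real_mult)
  qed
qed simp

lemma shear_has_vector_derivative:
  assumes "(f has_vector_derivative v) (at t)"
  shows "((\<lambda>t. shear c (f t)) has_vector_derivative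
    v + (c * (v $ 1 * f t $ 2 + f t $ 1 * v $ 2)) *\<^sub>R axis 3 1) (at t)"
proof -
  have "((\<lambda>t. f t $ i) has_real_derivative v $ i) (at t)" for i
    using bounded_linear.has_vector_derivative[OF bounded_linear_vec_nth assms]
    by (simp add: has_real_derivative_iff_has_vector_derivative)
  then have "((\<lambda>t. c * f t $ 1 * f t $ 2) has_real_derivative
      c * (v $ 1 * f t $ 2 + f t $ 1 * v $ 2)) (at t)"
    by (auto intro!: derivative_eq_intros simp: algebra_simps)
  then show ?thesis
    unfolding shear_def by (intro has_vector_derivative_add assms)
      (use has_vector_derivative_scaleR[OF _ has_vector_derivative_const] in fastforce)
qed

text \<open>The chain rule through shear, linear map and opposite shear; \<open>u\<close> and
  \<open>w\<close> are position and velocity after the first shear.\<close>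

lemma sheared_has_vector_derivative:
  fixes f :: "real \<Rightarrow> real^3" and B :: "real^3^3"
  assumes "(f has_vector_derivative v) (at t)"
  defines "w \<equiv> v + (-1/2 * (v $ 1 * f t $ 2 + f t $ 1 * v $ 2)) *\<^sub>R axis 3 1"
    and "u \<equiv> shear (-1/2) (f t)"
  shows "(sheared B f has_vector_derivative B *v w +
    (1/2 * ((B *v w) $ 1 * (B *v u) $ 2 + (B *v u) $ 1 * (B *v w) $ 2)) *\<^sub>R axis 3 1) (at t)"
proof -
  have "((\<lambda>t. B *v shear (-1/2) (f t)) has_vector_derivative B *v w) (at t)"
    unfolding w_def
    by (intro bounded_linear.has_vector_derivative[OF matrix_vector_mul_bounded_linear]
        shear_has_vector_derivative assms(1))
  from shear_has_vector_derivative[OF this, of "1/2"] show ?thesis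
    by (simp add: sheared_def[abs_def] u_def)
qed

text \<open>The inverse matrix \<open>C\<close> recovers \<open>f\<close> from its image, so a
  self-intersection or a zero of the velocity would be carried back to \<open>f\<close>.\<close>

lemma sheared_knot_embeddings:
  assumes f: "f \<in> knot_embeddings" and B: "invertible B"
  shows "sheared B f \<in> knot_embeddings"
proof -
  obtain C where C: "C ** B = mat 1" using B by (auto simp: invertible_def)
  let ?g = "sheared B f"
  have f_eq: "f = sheared C ?g" by (simp add: sheared_sheared C sheared_mat_1)
  have g: "?g \<in> smooth_circle_maps"
    using f by (intro smooth_circle_maps_sheared) (simp add: knot_embeddings_def)
  have "s - t \<in> \<int>" if "?g s = ?g t" for s t
  proof -
    have "f s = f t" using that by (subst (1 2) f_eq) (simp only: sheared_def[of C])
    then show ?thesis using f by (simp add: knot_embeddings_def)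
  qed
  moreover have "vector_derivative ?g (at t) \<noteq> 0" for t
  proof
    assume "vector_derivative ?g (at t) = 0"
    then have "(?g has_vector_derivative 0) (at t)"
      using smooth_has_vector_derivative[of ?g t] g by (simp add: smooth_circle_maps_def)
    from sheared_has_vector_derivative[OF this, of C] have "(f has_vector_derivative 0) (at t)"
      by (simp add: f_eq[symmetric])
    then have "vector_derivative f (at t) = 0" by (rule vector_derivative_at)
    then show False using f by (simp add: knot_embeddings_def)
  qed
  ultimately show ?thesis using g by (simp add: knot_embeddings_def)
qed

section \<open>Rotation matrices\<close>

definition rotz :: "real \<Rightarrow> real^3^3"
  where "rotz a = vector [vector [cos a, - sin a, 0], vector [sin a, cos a, 0], vector [0, 0, 1]]"

definition rotx :: "real \<Rightarrow> real^3^3"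
  where "rotx a = vector [vector [1, 0, 0], vector [0, cos a, - sin a], vector [0, sin a, cos a]]"

lemma rotz_0: "rotz 0 = mat 1"
  by (simp add: rotz_def vec_eq_iff forall_3 mat_def vector_3)

lemma rotz_add: "rotz a ** rotz b = rotz (a + b)"
  by (simp add: rotz_def vec_eq_iff forall_3 matrix_matrix_mult_def sum_3 vector_3 cos_add sin_add)

lemma rotx_0: "rotx 0 = mat 1"
  by (simp add: rotx_def vec_eq_iff forall_3 mat_def vector_3)

lemma rotx_add: "rotx a ** rotx b = rotx (a + b)"
  by (simp add: rotx_def vec_eq_iff forall_3 matrix_matrix_mult_def sum_3 vector_3 cos_add sin_add)

text \<open>A half turn about the x-axis reverses the z-axis, hence conjugates \<open>rotz a\<close>
  to \<open>rotz (- a)\<close>.\<close>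

lemma rotz_pi_conj: "rotz a ** rotx pi ** rotz a ** rotx (- pi) = mat 1"
  by (simp add: rotz_def rotx_def vec_eq_iff forall_3 matrix_matrix_mult_def mat_def sum_3 vector_3
      flip: power2_eq_square)

lemma invertible_rotz: "invertible (rotz a)"
  unfolding invertible_def by (intro exI[of _ "rotz (- a)"]) (simp add: rotz_add rotz_0)

lemma invertible_rotx: "invertible (rotx a)"
  unfolding invertible_def by (intro exI[of _ "rotx (- a)"]) (simp add: rotx_add rotx_0)

lemma continuous_on_matrix_mult_nth:
  fixes A :: "'a::topological_space \<Rightarrow> real^'n^'m" and B :: "'a \<Rightarrow> real^'k^'n"
  assumes "\<And>i j. continuous_on S (\<lambda>z. A z $ i $ j)" "\<And>i j. continuous_on S (\<lambda>z. B z $ i $ j)"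
  shows "continuous_on S (\<lambda>z. (A z ** B z) $ i $ j)"
  unfolding matrix_matrix_mult_def by (simp, intro continuous_intros assms)

lemma continuous_on_rot_nth:
  fixes a :: "'a::t2_space \<Rightarrow> real"
  assumes "continuous_on S a"
  shows "continuous_on S (\<lambda>z. rotz (a z) $ i $ j)" "continuous_on S (\<lambda>z. rotx (a z) $ i $ j)"
proof -
  have "continuous_on S (\<lambda>z. cos (a z))" "continuous_on S (\<lambda>z. sin (a z))"
    by (intro continuous_intros assms)+
  then show "continuous_on S (\<lambda>z. rotz (a z) $ i $ j)" "continuous_on S (\<lambda>z. rotx (a z) $ i $ j)"
    using exhaust_3[of i] exhaust_3[of j]
    by (elim disjE; simp add: rotz_def rotx_def vector_3 continuous_on_minus)+
qed

lemma sheared_rotz_nth: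
  "sheared (rotz a) f t $ 1 = cos a * f t $ 1 - sin a * f t $ 2"
  "sheared (rotz a) f t $ 2 = sin a * f t $ 1 + cos a * f t $ 2"
  by (simp_all add: sheared_def shear_nth rotz_def matrix_vector_mult_def sum_3 vector_3)

lemma vector_derivative_sheared_rotz_nth:
  assumes "(f has_vector_derivative v) (at t)"
  shows "vector_derivative (sheared (rotz a) f) (at t) $ 1 = cos a * v $ 1 - sin a * v $ 2"
    and "vector_derivative (sheared (rotz a) f) (at t) $ 2 = sin a * v $ 1 + cos a * v $ 2"
  unfolding vector_derivative_at[OF sheared_has_vector_derivative[OF assms]]
  by (simp_all add: rotz_def matrix_vector_mult_def sum_3 vector_3 axis_def)

lemma sheared_rotz_legendrian:
  assumes f: "f \<in> legendrian_embeddings"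
  shows "sheared (rotz a) f \<in> legendrian_embeddings"
proof -
  have fk: "f \<in> knot_embeddings" using f by (simp add: legendrian_embeddings_def)
  have "contact_form (sheared (rotz a) f t) (vector_derivative (sheared (rotz a) f) (at t)) = 0" for t
  proof -
    define v where "v = vector_derivative f (at t)"
    have v: "(f has_vector_derivative v) (at t)"
      using fk by (simp add: v_def knot_embeddings_def smooth_circle_maps_def smooth_has_vector_derivative)
    have "v $ 3 = f t $ 2 * v $ 1"
      using f by (simp add: legendrian_embeddings_def contact_form_def v_def)
    \<comment> \<open>The first summands form dw; the last is (x dy - y dx) / 2 times the
      determinant of the rotation, kept unevaluated until the end.\<close>
    moreover have "contact_form (sheared (rotz a) f t) (vector_derivative (sheared (rotz a) f) (at t)) =
      v $ 3 - (v $ 1 * f t $ 2 + f t $ 1 * v $ 2) / 2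
        + (cos a * cos a + sin a * sin a) * (f t $ 1 * v $ 2 - f t $ 2 * v $ 1) / 2"
      unfolding contact_form_def vector_derivative_at[OF sheared_has_vector_derivative[OF v]] sheared_rotz_nth
      by (simp add: rotz_def matrix_vector_mult_def sum_3 vector_3 axis_def shear_nth
          field_simps del: sin_cos_squared_add3)
    ultimately show ?thesis by (simp add: field_simps)
  qed
  then show ?thesis
    using sheared_knot_embeddings[OF fk invertible_rotz] by (simp add: legendrian_embeddings_def)
qed

section \<open>The phase of a Legendrian knot\<close>

text \<open>Logarithms of the same number differ by integral multiples of 2 \<pi> i, so the range of
  \<open>h\<close> is discrete.\<close>

lemma exp_const_imp_constant_on:
  fixes h :: "'a::topological_space \<Rightarrow> complex"
  assumes "connected S" "continuous_on S h" "\<And>t. t \<in> S \<Longrightarrow> exp (h t) = c"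
  shows "h constant_on S"
proof (rule continuous_discrete_range_constant[OF assms(1,2)])
  fix x assume "x \<in> S"
  show "\<exists>e>0. \<forall>y. y \<in> S \<and> h y \<noteq> h x \<longrightarrow> e \<le> norm (h y - h x)"
  proof (intro exI[of _ 1] conjI allI impI)
    fix y assume y: "y \<in> S \<and> h y \<noteq> h x"
    then obtain n :: int where n: "h y = h x + (of_int (2 * n) * pi) * \<i>"
      using assms(3) \<open>x \<in> S\<close> by (metis exp_eq)
    with y have "n \<noteq> 0" by auto
    then have "1 \<le> \<bar>real_of_int n\<bar>" by linarith
    then have "1 \<le> 2 * \<bar>real_of_int n\<bar> * pi"
      using pi_gt3 mult_mono[of 1 "\<bar>real_of_int n\<bar>" 3 pi] by auto
    then show "1 \<le> norm (h y - h x)" by (simp add: n norm_mult)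
  qed simp
qed

text \<open>The velocity of the Lagrangian projection; for a Legendrian knot its winding number is
  the rotation number.\<close>

definition tangent :: "(real \<Rightarrow> real^3) \<Rightarrow> real \<Rightarrow> complex"
  where "tangent f t = Complex (vector_derivative f (at t) $ 1) (vector_derivative f (at t) $ 2)"

text \<open>For a Legendrian knot, periodicity of \<open>\<theta>\<close> encodes rotation number 0;
  squaring removes the dependence on orientation.\<close>

definition phase_lift :: "(real \<Rightarrow> real^3) \<Rightarrow> (real \<Rightarrow> real) \<Rightarrow> bool"
  where "phase_lift f \<theta> \<longleftrightarrow> continuous_on UNIV \<theta> \<and> (\<forall>t. \<theta> (t + 1) = \<theta> t) \<and>
    (\<forall>t. (sgn (tangent f t))\<^sup>2 = cis (\<theta> t))"

text \<open>The junk value 0, taken when the rotation number is not 0, is isolated from the unit circle.\<close>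

definition phase :: "(real \<Rightarrow> real^3) \<Rightarrow> complex"
  where "phase f = (if \<exists>\<theta>. phase_lift f \<theta> then cis (Sup (range (SOME \<theta>. phase_lift f \<theta>))) else 0)"

lemma norm_phase: "norm (phase f) = (if \<exists>\<theta>. phase_lift f \<theta> then 1 else 0)"
  by (simp add: phase_def)

lemma phase_lift_Sup:
  assumes "phase_lift f \<theta>"
  obtains s where "Sup (range \<theta>) = \<theta> s" "\<And>t. \<theta> t \<le> \<theta> s"
proof -
  obtain s where s: "\<And>t. \<theta> t \<le> \<theta> s"
    using periodic_attains_sup[of \<theta>] assms unfolding phase_lift_def by metis
  then have "Sup (range \<theta>) = \<theta> s" by (intro cSup_eq_maximum) auto
  with s show thesis by (rule that[rotated])
qed

lemma phase_lift_unique: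
  assumes "phase_lift f \<theta>" "phase_lift f \<psi>"
  obtains c where "\<And>t. \<theta> t = \<psi> t + c" "cis c = 1"
proof -
  have c: "cis (\<theta> t - \<psi> t) = 1" for t
    using assms unfolding phase_lift_def by (simp add: cis_divide[symmetric])
  have "(\<lambda>t. \<i> * of_real (\<theta> t - \<psi> t)) constant_on UNIV"
    using assms c by (intro exp_const_imp_constant_on[where c = 1] continuous_intros)
      (auto simp: phase_lift_def cis_conv_exp[symmetric] simp del: of_real_diff)
  then obtain w where "\<And>t. \<i> * of_real (\<theta> t - \<psi> t) = w" by (auto simp: constant_on_def)
  then have "\<i> * of_real (\<theta> t - \<psi> t) = \<i> * of_real (\<theta> 0 - \<psi> 0)" for t by simp
  then have "\<theta> t = \<psi> t + (\<theta> 0 - \<psi> 0)" for t by (simp add: algebra_simps flip: of_real_diff of_real_add)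
  then show thesis using c[of 0] by (rule that)
qed

text \<open>Another lift shifts the supremum by some \<open>c\<close> with \<open>cis c = 1\<close>,
  so the choice made in \<open>phase\<close> is immaterial.\<close>

lemma phase_eq:
  assumes "phase_lift f \<theta>" shows "phase f = cis (Sup (range \<theta>))"
proof -
  define \<psi> where "\<psi> = (SOME \<theta>. phase_lift f \<theta>)"
  have \<psi>: "phase_lift f \<psi>" using assms unfolding \<psi>_def by (rule someI[of "phase_lift f"])
  obtain c where c: "\<And>t. \<theta> t = \<psi> t + c" "cis c = 1" by (rule phase_lift_unique[OF assms \<psi>]) (rule that)
  obtain s where s: "Sup (range \<psi>) = \<psi> s" "\<And>t. \<psi> t \<le> \<psi> s" using phase_lift_Sup[OF \<psi>] by blast
  have "Sup (range \<theta>) = \<psi> s + c"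
    using s(2) by (intro cSup_eq_maximum) (auto simp: c image_iff)
  then have "cis (Sup (range \<theta>)) = cis (Sup (range \<psi>))" by (simp add: s(1) c(2) cis_mult[symmetric])
  then show ?thesis using assms by (auto simp: phase_def \<psi>_def)
qed

lemma circle_diffeos_deriv:
  assumes "\<phi> \<in> circle_diffeos" shows "vector_derivative \<phi> (at t) \<noteq> 0"
proof
  assume 0: "vector_derivative \<phi> (at t) = 0"
  let ?i = "inv_into UNIV \<phi>"
  have s: "smooth \<phi>" "smooth ?i" and b: "bij \<phi>" using assms by (auto simp: circle_diffeos_def)
  have "((?i \<circ> \<phi>) has_vector_derivative 0 *\<^sub>R vector_derivative ?i (at (\<phi> t))) (at t)"
    using smooth_has_vector_derivative[OF s(1), of t] smooth_has_vector_derivative[OF s(2), of "\<phi> t"]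
    unfolding 0 by (intro vector_diff_chain_at)
  moreover have "?i \<circ> \<phi> = id" using b by (simp add: bij_is_inj)
  ultimately have "(id has_vector_derivative (0::real)) (at t)" by simp
  moreover have "(id has_vector_derivative (1::real)) (at t)"
    unfolding id_def by (rule has_vector_derivative_id)
  ultimately show False using vector_derivative_unique_at by force
qed

text \<open>Reparametrization multiplies the tangent by a nonzero real factor, whose sign disappears
  in the square.\<close>

lemma phase_lift_reparam:
  assumes f: "smooth f" and \<phi>: "\<phi> \<in> circle_diffeos" and \<theta>: "phase_lift f \<theta>"
  shows "phase_lift (f \<circ> \<phi>) (\<theta> \<circ> \<phi>)"
proof -
  have s: "smooth \<phi>" and p: "(\<forall>t. \<phi> (t + 1) = \<phi> t + 1) \<or> (\<forall>t. \<phi> (t + 1) = \<phi> t - 1)"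
    using \<phi> by (auto simp: circle_diffeos_def)
  have per: "\<theta> (t + 1) = \<theta> t" for t using \<theta> by (simp add: phase_lift_def)
  have "continuous_on UNIV (\<theta> \<circ> \<phi>)"
    using \<theta> smooth_continuous_on[OF s]
    by (intro continuous_on_compose) (auto simp: phase_lift_def intro: continuous_on_subset)
  moreover have "\<theta> (\<phi> (t + 1)) = \<theta> (\<phi> t)" for t
    using p per[of "\<phi> t"] per[of "\<phi> t - 1"] by auto
  moreover have "(sgn (tangent (f \<circ> \<phi>) t))\<^sup>2 = (sgn (tangent f (\<phi> t)))\<^sup>2" for t
  proof -
    let ?d = "vector_derivative \<phi> (at t)"
    have "((f \<circ> \<phi>) has_vector_derivative ?d *\<^sub>R vector_derivative f (at (\<phi> t))) (at t)"
      by (intro vector_diff_chain_at smooth_has_vector_derivative f s)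
    then have "tangent (f \<circ> \<phi>) t = ?d *\<^sub>R tangent f (\<phi> t)"
      by (simp add: tangent_def vector_derivative_at complex_eq_iff)
    moreover have "sgn ?d = 1 \<or> sgn ?d = -1"
      using circle_diffeos_deriv[OF \<phi>, of t] by (simp add: sgn_real_def)
    ultimately show ?thesis by (auto simp: sgn_scaleR)
  qed
  ultimately show ?thesis using \<theta> by (simp add: phase_lift_def)
qed

text \<open>A supremum over the whole range does not see the parametrization, as
  \<open>\<phi>\<close> is onto. The inverse diffeomorphism shows that absence of a lift is
  preserved too.\<close>

lemma phase_reparam:
  assumes f: "smooth f" and \<phi>: "\<phi> \<in> circle_diffeos"
  shows "phase (f \<circ> \<phi>) = phase f"
proof (cases "\<exists>\<theta>. phase_lift f \<theta>")
  case True
  then obtain \<theta> where \<theta>: "phase_lift f \<theta>" by blast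
  have "surj \<phi>" using \<phi> by (simp add: circle_diffeos_def bij_is_surj)
  then have "range (\<theta> \<circ> \<phi>) = range \<theta>" by (simp only: image_comp[symmetric])
  then show ?thesis using phase_eq[OF phase_lift_reparam[OF f \<phi> \<theta>]] phase_eq[OF \<theta>] by simp
next
  case False
  have "\<nexists>\<theta>. phase_lift (f \<circ> \<phi>) \<theta>"
  proof
    assume "\<exists>\<theta>. phase_lift (f \<circ> \<phi>) \<theta>"
    then obtain \<theta> where \<theta>: "phase_lift (f \<circ> \<phi>) \<theta>" by blast
    have "smooth (f \<circ> \<phi>)" using \<phi> by (intro smooth_compose f) (simp add: circle_diffeos_def)
    from phase_lift_reparam[OF this circle_diffeos_inv[OF \<phi>] \<theta>]
    have "phase_lift (f \<circ> (\<phi> \<circ> inv_into UNIV \<phi>)) (\<theta> \<circ> inv_into UNIV \<phi>)" by (simp add: o_assoc)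
    moreover have "\<phi> \<circ> inv_into UNIV \<phi> = id"
      using \<phi> by (intro ext) (simp add: circle_diffeos_def bij_is_surj surj_f_inv_f)
    ultimately show False using False by auto
  qed
  with False show ?thesis by (simp add: phase_def)
qed

lemma legendrian_smooth:
  "f \<in> legendrian_embeddings \<Longrightarrow> smooth f"
  "f \<in> legendrian_embeddings \<Longrightarrow> f \<in> smooth_circle_maps"
  by (simp_all add: legendrian_embeddings_def knot_embeddings_def smooth_circle_maps_def)

text \<open>The Legendrian equation dz = y dx makes a velocity without (x, y)-part vanish
  altogether.\<close>

lemma tangent_nonzero:
  assumes "f \<in> legendrian_embeddings" shows "tangent f t \<noteq> 0"
proof
  assume "tangent f t = 0"
  moreover have "contact_form (f t) (vector_derivative f (at t)) = 0" "vector_derivative f (at t) \<noteq> 0"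
    using assms by (auto simp: legendrian_embeddings_def knot_embeddings_def)
  ultimately show False
    by (simp add: tangent_def complex_eq_iff contact_form_def vec_eq_iff forall_3)
qed

lemma tangent_periodic:
  assumes "f \<in> legendrian_embeddings" shows "tangent f (t + 1) = tangent f t"
  using smooth_circle_maps_periodic[OF legendrian_smooth(2)[OF assms], of 1 t]
  by (simp add: tangent_def nderiv_Suc)

lemma continuous_on_tangent:
  assumes "f \<in> legendrian_embeddings" shows "continuous_on S (tangent f)"
proof -
  have "continuous_on S (\<lambda>t. vector_derivative f (at t) $ i)" for i
    by (intro smooth_continuous_on smooth_nth smooth_deriv legendrian_smooth assms)
  then show ?thesis unfolding tangent_def[abs_def] Complex_eq
    by (intro continuous_on_add continuous_on_mult continuous_on_of_real continuous_on_const)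
qed

text \<open>Serves two comparisons: a small perturbation of a knot, and a rotation by a constant
  angle.\<close>

lemma phase_lift_twist:
  assumes "continuous_on UNIV h" "\<And>t. h (t + 1) = h t"
    and "\<And>t. (sgn (tangent g t))\<^sup>2 = (sgn (tangent f t))\<^sup>2 * cis (h t)"
    and "phase_lift f \<theta>"
  shows "phase_lift g (\<lambda>t. \<theta> t + h t)"
  using assms by (auto simp: phase_lift_def cis_mult intro!: continuous_intros)

section \<open>Continuity of the phase\<close>

lemma dist_cis_le: "dist (cis a) (cis b) \<le> \<bar>a - b\<bar>"
proof -
  have "dist (cis a) (cis b) = norm (cis b * (cis (a - b) - 1))"
    by (simp add: dist_norm right_diff_distrib cis_mult)
  also have "\<dots> = 2 * \<bar>sin ((a - b) / 2)\<bar>"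
    by (simp only: norm_mult norm_exp_i_times cis_conv_exp dist_exp_i_1 mult_1)
  also have "\<dots> \<le> \<bar>a - b\<bar>" using abs_sin_x_le_abs_x[of "(a - b) / 2"] by simp
  finally show ?thesis .
qed

text \<open>The quotient of the tangents stays in the right half-plane, so twice its principal
  argument is a continuous periodic \<open>h\<close> that turns lifts for \<open>f\<close> into
  lifts for \<open>g\<close>. As \<open>h\<close> is smaller than \<open>e\<close>, the supremum
  moves by at most \<open>e\<close>.\<close>

lemma phase_close:
  assumes f: "f \<in> legendrian_embeddings" and g: "g \<in> legendrian_embeddings"
    and q: "\<And>t. norm (tangent g t / tangent f t - 1) < 1"
      "\<And>t. 2 * \<bar>Im (Ln (tangent g t / tangent f t))\<bar> < e" and "e > 0"
  shows "dist (phase g) (phase f) \<le> e"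
proof -
  define h where "h t = 2 * Im (Ln (tangent g t / tangent f t))" for t
  have pos: "tangent g t / tangent f t \<notin> \<real>\<^sub>\<le>\<^sub>0" for t
  proof -
    have "Re (tangent g t / tangent f t) > 0"
      using q(1)[of t] abs_Re_le_cmod[of "tangent g t / tangent f t - 1"] by simp
    then show ?thesis by (auto simp: complex_nonpos_Reals_iff)
  qed
  have h: "continuous_on UNIV h" "h (t + 1) = h t" for t
    unfolding h_def using pos
    by (auto intro!: continuous_intros continuous_on_tangent f g simp: tangent_nonzero[OF f]
        tangent_periodic[OF f] tangent_periodic[OF g])
  have sg: "(sgn (tangent g t))\<^sup>2 = (sgn (tangent f t))\<^sup>2 * cis (h t)" for t
  proof -
    have "sgn (tangent g t / tangent f t) = cis (Im (Ln (tangent g t / tangent f t)))"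
      using tangent_nonzero[OF f, of t] tangent_nonzero[OF g, of t]
      by (metis cis_Arg Arg_eq_Im_Ln divide_eq_0_iff)
    then have "(sgn (tangent g t / tangent f t))\<^sup>2 = cis (h t)"
      by (simp add: h_def power2_eq_square cis_mult)
    moreover have "sgn (tangent g t) = sgn (tangent f t) * sgn (tangent g t / tangent f t)"
      using sgn_mult[of "tangent f t" "tangent g t / tangent f t"] tangent_nonzero[OF f, of t]
      by (simp only: nonzero_mult_div_cancel_left times_divide_eq_right not_False_eq_True)
    ultimately show ?thesis by (simp only: power_mult_distrib)
  qed
  show ?thesis
  proof (cases "\<exists>\<theta>. phase_lift f \<theta>")
    case True
    then obtain \<theta> where \<theta>: "phase_lift f \<theta>" by blast
    have \<psi>: "phase_lift g (\<lambda>t. \<theta> t + h t)" by (rule phase_lift_twist[OF h sg \<theta>])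
    obtain s where s: "Sup (range \<theta>) = \<theta> s" "\<And>t. \<theta> t \<le> \<theta> s" using phase_lift_Sup[OF \<theta>] by blast
    obtain r where r: "Sup (range (\<lambda>t. \<theta> t + h t)) = \<theta> r + h r" "\<And>t. \<theta> t + h t \<le> \<theta> r + h r"
      using phase_lift_Sup[OF \<psi>] by blast
    have "\<bar>h t\<bar> < e" for t using q(2)[of t] by (simp add: h_def)
    \<comment> \<open>Compare the maximizers: \<open>\<theta> r\<close> is at most
      \<open>\<theta> s\<close>, and \<open>\<theta> s + h s\<close> is at most
      \<open>\<theta> r + h r\<close>.\<close>
    then have "\<bar>(\<theta> r + h r) - \<theta> s\<bar> \<le> e" using s(2)[of r] r(2)[of s] by (smt (verit))
    then show ?thesis
      using dist_cis_le[of "\<theta> r + h r" "\<theta> s"] by (simp add: phase_eq[OF \<theta>] phase_eq[OF \<psi>] s r)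
  next
    case False
    \<comment> \<open>Subtracting \<open>h\<close> would carry a lift back to \<open>f\<close>, so
      both phases take the default value 0.\<close>
    have "\<not> phase_lift g \<psi>" for \<psi>
    proof
      assume "phase_lift g \<psi>"
      moreover have "(sgn (tangent f t))\<^sup>2 = (sgn (tangent g t))\<^sup>2 * cis (- h t)" for t
        unfolding sg by (simp add: mult.assoc cis_mult)
      ultimately have "phase_lift f (\<lambda>t. \<psi> t + - h t)"
        using h by (intro phase_lift_twist[of _ f g]) (auto intro!: continuous_intros)
      with False show False by blast
    qed
    with False \<open>e > 0\<close> show ?thesis by (simp add: phase_def)
  qed
qed

lemma phase_continuous:
  assumes f: "f \<in> legendrian_embeddings" and "e > 0"
  obtains d where "d > 0" "\<And>g. g \<in> legendrian_embeddings \<Longrightarrow>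
    (\<And>t. norm (nderiv 1 g t - nderiv 1 f t) < d) \<Longrightarrow> dist (phase g) (phase f) \<le> e"
proof -
  \<comment> \<open>The minimum speed of the projection, found as a maximum of the negative.\<close>
  obtain s where s: "\<And>t. - norm (tangent f t) \<le> - norm (tangent f s)"
    by (rule periodic_attains_sup[of "\<lambda>t. - norm (tangent f t)"])
      (auto intro!: continuous_intros continuous_on_tangent f simp: tangent_periodic[OF f])
  define m where "m = norm (tangent f s)"
  have m: "m > 0" "\<And>t. m \<le> norm (tangent f t)" using s tangent_nonzero[OF f] by (auto simp: m_def)
  have "isCont Ln 1" by (rule continuous_at_Ln) auto
  then obtain d where d: "d > 0" "\<And>q. dist q 1 < d \<Longrightarrow> dist (Ln q) (Ln 1) < e / 2"
    using half_gt_zero[OF \<open>e > 0\<close>] unfolding continuous_at_eps_delta by blast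
  show thesis
  proof (rule that)
    \<comment> \<open>\<open>m\<close> makes the velocity bound relative, 1 keeps the quotient in
      the right half-plane, \<open>d\<close> controls its logarithm, and the halving pays for the
      two components of the tangent.\<close>
    show "min d 1 * m / 2 > 0" using d m by simp
    fix g assume g: "g \<in> legendrian_embeddings"
      and close: "\<And>t. norm (nderiv 1 g t - nderiv 1 f t) < min d 1 * m / 2"
    have q: "norm (tangent g t / tangent f t - 1) < min d 1" for t
    proof -
      let ?v = "nderiv 1 g t - nderiv 1 f t"
      have "tangent g t - tangent f t = Complex (?v $ 1) (?v $ 2)"
        by (simp add: tangent_def nderiv_Suc complex_eq_iff)
      then have "norm (tangent g t - tangent f t) \<le> \<bar>?v $ 1\<bar> + \<bar>?v $ 2\<bar>"
        using cmod_le[of "Complex (?v $ 1) (?v $ 2)"] by simp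
      also have "\<dots> \<le> norm ?v + norm ?v" by (intro add_mono component_le_norm_cart)
      also have "\<dots> < min d 1 * m" using close[of t] by simp
      also have "\<dots> \<le> min d 1 * norm (tangent f t)" using d m by (intro mult_left_mono) auto
      finally have "norm (tangent g t - tangent f t) / norm (tangent f t) < min d 1"
        using tangent_nonzero[OF f, of t] by (simp only: pos_divide_less_eq zero_less_norm_iff not_False_eq_True simp_thms)
      moreover have "tangent g t / tangent f t - 1 = (tangent g t - tangent f t) / tangent f t"
        using tangent_nonzero[OF f, of t] by (simp add: field_simps)
      ultimately show ?thesis by (simp add: norm_divide)
    qed
    show "dist (phase g) (phase f) \<le> e"
    proof (rule phase_close[OF f g])
      show "norm (tangent g t / tangent f t - 1) < 1" for t using q[of t] by simp
      show "2 * \<bar>Im (Ln (tangent g t / tangent f t))\<bar> < e" for t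
        using d(2)[of "tangent g t / tangent f t"] q[of t]
          abs_Im_le_cmod[of "Ln (tangent g t / tangent f t)"] by (simp add: dist_norm)
    qed fact
  qed
qed

section \<open>Spinning a knot\<close>

lemma continuous_map_phase:
  "continuous_map (subtopology Cinf_topology legendrian_embeddings) euclidean phase"
proof -
  have "\<exists>U. openin (subtopology Cinf_topology legendrian_embeddings) U \<and> f \<in> U
      \<and> (\<forall>g\<in>U. phase g \<in> ball (phase f) e)"
    if f: "f \<in> legendrian_embeddings" and "e > 0" for f e
  proof -
    \<comment> \<open>The bound supplied is not strict, so \<open>e / 2\<close> is used to land in
      the open ball.\<close>
    obtain d where d: "d > 0" "\<And>g. g \<in> legendrian_embeddings \<Longrightarrow>
        (\<And>t. norm (nderiv 1 g t - nderiv 1 f t) < d) \<Longrightarrow> dist (phase g) (phase f) \<le> e / 2"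
      using phase_continuous[OF f half_gt_zero[OF \<open>e > 0\<close>]] by metis
    let ?U = "legendrian_embeddings \<inter> Cinf_nbhd f 1 d"
    have "dist (phase f) (phase g) < e" if "g \<in> ?U" for g
      using d(2)[of g] that \<open>e > 0\<close> by (simp add: Cinf_nbhd_def dist_commute)
    moreover have "openin (subtopology Cinf_topology legendrian_embeddings) ?U"
      using openin_Cinf_nbhd[OF legendrian_smooth(2)[OF f] d(1), of 1]
      by (simp add: openin_subtopology_Int2)
    moreover have "f \<in> ?U" using f d(1) by (simp add: Cinf_nbhd_def legendrian_smooth)
    ultimately show ?thesis by (intro exI[of _ ?U]) simp
  qed
  then show ?thesis
    using Met_TC.continuous_map_to_metric[of "subtopology Cinf_topology legendrian_embeddings" phase]
    by simp
qed

text \<open>For Legendrian knots the choice of representative is harmless by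
  \<open>phase_reparam\<close>.\<close>

definition knot_phase :: "(real \<Rightarrow> real^3) set \<Rightarrow> complex"
  where "knot_phase k = phase (SOME f. f \<in> k)"

lemma knot_phase_knot_class:
  assumes "f \<in> legendrian_embeddings" shows "knot_phase (knot_class f) = phase f"
proof -
  have "f \<in> knot_class f" using knot_classI[OF id_circle_diffeos, of f] by simp
  then have "(SOME g. g \<in> knot_class f) \<in> knot_class f" by (rule someI[of "\<lambda>g. g \<in> knot_class f"])
  then obtain \<phi> where "\<phi> \<in> circle_diffeos" "(SOME g. g \<in> knot_class f) = f \<circ> \<phi>" by (rule knot_classE)
  then show ?thesis
    unfolding knot_phase_def using phase_reparam[OF legendrian_smooth(1)[OF assms]] by simp
qed

lemma continuous_map_knot_phase: "continuous_map Leg_space euclidean knot_phase"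
  unfolding Leg_space_def
proof (rule continuous_compose_quotient_map[OF quotient_map_quotient_topology])
  show "continuous_map (subtopology Cinf_topology legendrian_embeddings) euclidean (knot_phase \<circ> knot_class)"
    by (rule continuous_map_eq[OF continuous_map_phase]) (simp add: knot_phase_knot_class)
qed

text \<open>The norm of the phase is continuous with values 0 and 1 only, so on a connected set it
  cannot take both.\<close>

lemma knot_phase_nonzero:
  assumes L: "connectedin Leg_space L" and "k \<in> L" "l \<in> L" "knot_phase l \<noteq> 0"
  shows "knot_phase k \<noteq> 0"
proof
  assume 0: "knot_phase k = 0"
  have "continuous_map Leg_space euclideanreal (\<lambda>k. norm (knot_phase k))"
    by (rule continuous_map_compose[OF continuous_map_knot_phase, of euclideanreal norm, unfolded o_def])
      (auto intro!: continuous_intros)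
  from connectedin_continuous_map_image[OF this L]
  have "connected ((\<lambda>k. norm (knot_phase k)) ` L)" by simp
  moreover have "norm (knot_phase l) = 1"
    using assms(4) norm_phase[of "SOME f. f \<in> l"] by (auto simp: knot_phase_def split: if_splits)
  ultimately have "1/2 \<in> (\<lambda>k. norm (knot_phase k)) ` L"
    using connectedD_interval[of _ "norm (knot_phase k)" "norm (knot_phase l)" "1/2"] assms(2,3) 0
    by auto
  then show False unfolding knot_phase_def norm_phase by (auto split: if_splits)
qed

text \<open>The turn multiplies the tangent by \<open>cis a\<close>, hence its squared direction by
  \<open>cis (2 * a)\<close>, so adding \<open>2 * a\<close> to a lift gives a lift.\<close>

lemma phase_sheared_rotz:
  assumes f: "f \<in> legendrian_embeddings" and "phase f \<noteq> 0"
  shows "phase (sheared (rotz a) f) = cis (2 * a) * phase f"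
proof -
  obtain \<theta> where \<theta>: "phase_lift f \<theta>" using assms(2) by (auto simp: phase_def split: if_splits)
  have tan: "tangent (sheared (rotz a) f) t = cis a * tangent f t" for t
    unfolding tangent_def
    using vector_derivative_sheared_rotz_nth[OF smooth_has_vector_derivative[OF legendrian_smooth(1)[OF f]]]
    by (simp add: complex_eq_iff)
  have "(sgn (tangent (sheared (rotz a) f) t))\<^sup>2 = (sgn (tangent f t))\<^sup>2 * cis (2 * a)" for t
  proof -
    have "sgn (cis a) = cis a" "cis (2 * a) = cis a * cis a" by (simp_all add: sgn_eq cis_mult)
    then show ?thesis using tan[of t] by (simp add: sgn_mult power2_eq_square mult_ac)
  qed
  then have *: "phase_lift (sheared (rotz a) f) (\<lambda>t. \<theta> t + 2 * a)"
    by (intro phase_lift_twist[OF _ _ _ \<theta>]) auto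
  obtain s where s: "Sup (range \<theta>) = \<theta> s" "\<And>t. \<theta> t \<le> \<theta> s" using phase_lift_Sup[OF \<theta>] by blast
  have "Sup (range (\<lambda>t. \<theta> t + 2 * a)) = \<theta> s + 2 * a"
    using s(2) by (intro cSup_eq_maximum) auto
  then show ?thesis by (simp add: phase_eq[OF *] phase_eq[OF \<theta>] s(1) cis_mult add.commute)
qed

section \<open>The spinning loop and its contraction through smooth knots\<close>

text \<open>
  With \<open>R\<close> a rotation about the \<open>z\<close>-axis and \<open>A\<close> one about the \<open>x\<close>-axis by \<open>\<pi> s\<close>, the product
  \<open>R A R A\<^sup>-\<^sup>1\<close> is the double turn \<open>R\<^sup>2\<close> at \<open>s = 0\<close>, and the identity at \<open>s = 1\<close>, where \<open>A\<close> conjugates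
  \<open>R\<close> to its inverse.
\<close>

definition spin :: "real \<times> real \<Rightarrow> real^3^3"
  where "spin z = rotz (2 * pi * snd z) ** rotx (pi * fst z) ** rotz (2 * pi * snd z) ** rotx (- (pi * fst z))"

text \<open>For t = 0 and t = 1 the \<open>rotz\<close> factors are trivial and the
  \<open>rotx\<close> factors cancel, so the deformation fixes the base point.\<close>

lemma spin_edges:
  "spin (0, t) = rotz (4 * pi * t)" "spin (1, t) = mat 1" "spin (s, 0) = mat 1" "spin (s, 1) = mat 1"
proof -
  have 1: "rotz (2 * pi) = mat 1" by (simp add: rotz_def rotz_0[symmetric])
  show "spin (0, t) = rotz (4 * pi * t)" by (simp add: spin_def rotx_0 rotz_add mult.assoc)
  show "spin (1, t) = mat 1" by (simp add: spin_def rotz_pi_conj)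
  show "spin (s, 0) = mat 1" "spin (s, 1) = mat 1" by (simp_all add: spin_def rotx_0 rotz_0 rotx_add 1)
qed

lemma invertible_spin: "invertible (spin z)"
  unfolding spin_def by (intro invertible_mult invertible_rotx invertible_rotz)

lemma continuous_on_spin_nth: "continuous_on S (\<lambda>z. spin z $ i $ j)"
  unfolding spin_def
  by (intro continuous_on_matrix_mult_nth continuous_on_rot_nth continuous_intros)

lemma continuous_map_knot_class_Emb:
  assumes "continuous_map X Cinf_topology F" "\<And>z. z \<in> topspace X \<Longrightarrow> F z \<in> knot_embeddings"
  shows "continuous_map X Emb_space (\<lambda>z. knot_class (F z))"
proof -
  have "continuous_map X (subtopology Cinf_topology knot_embeddings) F"
    using assms by (auto simp: continuous_map_in_subtopology)
  from continuous_map_compose[OF this quotient_imp_continuous_map[OF quotient_map_quotient_topology]]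
  show ?thesis by (simp add: Emb_space_def o_def)
qed

lemma continuous_map_knot_class_Leg:
  assumes "continuous_map X Cinf_topology F" "\<And>z. z \<in> topspace X \<Longrightarrow> F z \<in> legendrian_embeddings"
  shows "continuous_map X Leg_space (\<lambda>z. knot_class (F z))"
proof -
  have "continuous_map X (subtopology Cinf_topology legendrian_embeddings) F"
    using assms by (auto simp: continuous_map_in_subtopology)
  from continuous_map_compose[OF this quotient_imp_continuous_map[OF quotient_map_quotient_topology]]
  show ?thesis by (simp add: Leg_space_def o_def)
qed

text \<open>A connected image meeting a component stays inside it; this confines loops and
  homotopies to one knot type.\<close>

lemma continuous_map_into_component:
  assumes C: "C \<in> connected_components_of X" and h: "continuous_map Z X h" and Z: "connected_space Z"
    and "z \<in> topspace Z" "h z \<in> C"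
  shows "continuous_map Z (subtopology X C) h"
proof -
  have "connectedin X (h ` topspace Z)"
    using Z by (intro connectedin_continuous_map_image[OF h]) (simp add: connectedin_topspace)
  then have "h ` topspace Z \<subseteq> C"
    by (rule connected_components_of_maximal[OF C]) (use assms(4,5) in \<open>auto simp: disjnt_iff\<close>)
  then show ?thesis using h by (auto simp: continuous_map_in_subtopology)
qed

text \<open>The factor \<open>4 * pi\<close> makes two full turns; a single one is not contractible
  in SO(3).\<close>

definition spin_loop :: "(real \<Rightarrow> real^3) \<Rightarrow> real \<Rightarrow> (real \<Rightarrow> real^3) set"
  where "spin_loop f t = knot_class (sheared (rotz (4 * pi * t)) f)"

lemma spin_loop_ends: "spin_loop f 0 = knot_class f" "spin_loop f 1 = knot_class f"
proof -
  have "rotz (4 * pi) = rotz (2 * pi) ** rotz (2 * pi)" by (simp add: rotz_add)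
  moreover have "rotz (2 * pi) = mat 1" by (simp add: rotz_def rotz_0[symmetric])
  ultimately show "spin_loop f 0 = knot_class f" "spin_loop f 1 = knot_class f"
    by (simp_all add: spin_loop_def rotz_0 sheared_mat_1)
qed

lemma spin_loop_loops:
  assumes f: "f \<in> legendrian_embeddings" and L: "L \<in> legendrian_knot_types" "knot_class f \<in> L"
  shows "spin_loop f \<in> loops (subtopology Leg_space L) (knot_class f)"
proof -
  have "continuous_map (top_of_set {0..1}) Cinf_topology (\<lambda>t. sheared (rotz (4 * pi * t)) f)"
    by (intro continuous_map_sheared legendrian_smooth f)
      (simp, intro continuous_on_rot_nth continuous_intros)
  then have "continuous_map (top_of_set {0..1}) Leg_space (spin_loop f)"
    unfolding spin_loop_def[abs_def]
    by (intro continuous_map_knot_class_Leg sheared_rotz_legendrian f)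
  then have "continuous_map (top_of_set {0..1}) (subtopology Leg_space L) (spin_loop f)"
    by (rule continuous_map_into_component[where z = 0, rotated])
      (use L in \<open>auto simp: legendrian_knot_types_def spin_loop_ends connected_space_subtopology connectedin_topspace\<close>)
  then show ?thesis by (simp add: loops_def pathin_def spin_loop_ends)
qed

text \<open>\<open>spin\<close> supplies the contraction. Rotations about the x-axis need not
  preserve the contact form, so the intermediate knots are only known to be smooth.\<close>

lemma spin_loop_null_homotopic_Emb:
  assumes f: "f \<in> knot_embeddings" and K: "K \<in> smooth_knot_types" "knot_class f \<in> K"
  shows "loop_homotopic (subtopology Emb_space K) (knot_class f) (spin_loop f) (\<lambda>_. knot_class f)"
proof -
  let ?Q = "prod_topology (top_of_set {0..1::real}) (top_of_set {0..1::real})"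
  define H where "H = (\<lambda>z. knot_class (sheared (spin z) f))"
  have "f \<in> smooth_circle_maps" using f by (simp add: knot_embeddings_def)
  then have "continuous_map ?Q Cinf_topology (\<lambda>z. sheared (spin z) f)"
    by (intro continuous_map_sheared)
      (simp_all add: prod_topology_subtopology_eu continuous_on_spin_nth)
  then have "continuous_map ?Q Emb_space H"
    unfolding H_def by (intro continuous_map_knot_class_Emb sheared_knot_embeddings f invertible_spin)
  moreover have "connected_space ?Q"
    by (simp add: connected_space_prod_topology connected_space_subtopology)
  ultimately have "continuous_map ?Q (subtopology Emb_space K) H"
    using K by (intro continuous_map_into_component[where z = "(0, 0)"])
      (auto simp: smooth_knot_types_def H_def spin_edges sheared_mat_1)
  then show ?thesis
    unfolding loop_homotopic_def homotopic_with_def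
    by (intro exI[of _ H]) (simp add: H_def spin_edges sheared_mat_1 spin_loop_def)
qed

section \<open>The spinning loop is essential among Legendrian knots\<close>

text \<open>Compares the increments of a logarithm of \<open>W\<close> along the four edges.\<close>

lemma no_square_filling:
  fixes W :: "real \<times> real \<Rightarrow> complex"
  assumes W: "continuous_on ({0..1} \<times> {0..1}) W" "\<And>z. z \<in> {0..1} \<times> {0..1} \<Longrightarrow> W z \<noteq> 0"
    and edges: "\<And>t. t \<in> {0..1} \<Longrightarrow> W (0, t) = cis (8 * pi * t) * c" "\<And>t. t \<in> {0..1} \<Longrightarrow> W (1, t) = c"
      "\<And>s. s \<in> {0..1} \<Longrightarrow> W (s, 0) = W (s, 1)"
  shows False
proof -
  have "convex ({0..1::real} \<times> {0..1::real})" by (intro convex_Times) auto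
  then obtain g where g: "continuous_on ({0..1} \<times> {0..1}) g"
      "\<And>z. z \<in> {0..1} \<times> {0..1} \<Longrightarrow> W z = exp (g z)"
    using continuous_logarithm_on_contractible[OF W(1) convex_imp_contractible W(2)] by blast
  have const: "h 0 = h 1"
    if "continuous_on {0..1::real} h" "\<And>t. t \<in> {0..1} \<Longrightarrow> exp (h t) = b" for h :: "real \<Rightarrow> complex" and b
    using exp_const_imp_constant_on[OF _ that] by (force simp: constant_on_def)
  have gc: "continuous_on {0..1} (\<lambda>t. g (s, t))" "continuous_on {0..1} (\<lambda>t. g (t, s))"
    if "s \<in> {0..1}" for s
    by (rule continuous_on_compose2[OF g(1)]; use that in \<open>auto intro!: continuous_intros\<close>)+
  have "g (1, 0) = g (1, 1)"
    by (rule const[of _ c]) (use gc g(2) edges(2) in auto)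
  \<comment> \<open>Subtracting the known argument leaves a logarithm of the constant
    \<open>c\<close>, so \<open>g\<close> grows by 8 \<pi> i along this edge.\<close>
  moreover have "g (0, 0) - \<i> * of_real (8 * pi * 0) = g (0, 1) - \<i> * of_real (8 * pi * 1)"
  proof (rule const[of _ c])
    show "continuous_on {0..1} (\<lambda>t. g (0, t) - \<i> * of_real (8 * pi * t))"
      using gc by (intro continuous_intros) auto
    show "exp (g (0, t) - \<i> * of_real (8 * pi * t)) = c" if "t \<in> {0..1}" for t
    proof -
      have "exp (g (0, t)) = exp (\<i> * of_real (8 * pi * t)) * c"
        using g(2)[of "(0, t)"] edges(1)[OF that] that by (simp add: cis_conv_exp)
      then show ?thesis by (simp add: exp_diff)
    qed
  qed
  \<comment> \<open>\<open>W\<close> agrees on the edges t = 0 and t = 1, so their logarithms differ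
    by a constant. The increments at s = 0 and s = 1 are then equal: 8 \<pi> i against 0.\<close>
  moreover have "g (0, 1) - g (0, 0) = g (1, 1) - g (1, 0)"
  proof (rule const[of _ 1])
    show "continuous_on {0..1} (\<lambda>s. g (s, 1) - g (s, 0))" using gc by (intro continuous_intros) auto
    show "exp (g (s, 1) - g (s, 0)) = 1" if "s \<in> {0..1}" for s
      using g(2)[of "(s, 0)"] g(2)[of "(s, 1)"] edges(3)[OF that] that by (simp add: exp_diff)
  qed
  ultimately show False by simp
qed

text \<open>A null-homotopy stays in \<open>L\<close>, where the phase has no zeros; composing it
  with \<open>knot_phase\<close> would give a filling excluded by
  \<open>no_square_filling\<close>.\<close>

lemma spin_loop_essential_Leg:
  assumes f: "f \<in> legendrian_embeddings" and "phase f \<noteq> 0"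
    and L: "L \<in> legendrian_knot_types" "knot_class f \<in> L"
  shows "\<not> loop_homotopic (subtopology Leg_space L) (knot_class f) (spin_loop f) (\<lambda>_. knot_class f)"
proof
  let ?Q = "prod_topology (top_of_set {0..1::real}) (top_of_set {0..1::real})"
  assume "loop_homotopic (subtopology Leg_space L) (knot_class f) (spin_loop f) (\<lambda>_. knot_class f)"
  then obtain H where H: "continuous_map ?Q (subtopology Leg_space L) H"
      "\<And>t. H (0, t) = spin_loop f t" "\<And>t. H (1, t) = knot_class f"
      "\<And>s. s \<in> {0..1} \<Longrightarrow> H (s, 0) = knot_class f \<and> H (s, 1) = knot_class f"
    unfolding loop_homotopic_def homotopic_with_def by auto
  have L': "connectedin Leg_space L"
    using L(1) by (simp add: legendrian_knot_types_def connectedin_connected_components_of)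
  have k: "knot_phase (knot_class f) = phase f" by (rule knot_phase_knot_class[OF f])
  show False
  proof (rule no_square_filling)
    have "continuous_map ?Q euclidean (knot_phase \<circ> H)"
      using H(1) by (intro continuous_map_compose[OF _ continuous_map_knot_phase])
        (simp add: continuous_map_in_subtopology)
    then show "continuous_on ({0..1} \<times> {0..1}) (knot_phase \<circ> H)"
      by (simp add: prod_topology_subtopology_eu)
    show "(knot_phase \<circ> H) z \<noteq> 0" if "z \<in> {0..1} \<times> {0..1}" for z
    proof -
      have "H z \<in> L" using H(1) that by (auto simp: continuous_map_in_subtopology)
      then show ?thesis using knot_phase_nonzero[OF L' _ L(2)] assms(2) k by simp
    qed
    \<comment> \<open>The rotation angle \<open>4 * pi * t\<close> is doubled by squaring the
      direction, whence four windings.\<close>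
    show "(knot_phase \<circ> H) (0, t) = cis (8 * pi * t) * phase f" for t
      by (simp add: H(2) spin_loop_def knot_phase_knot_class sheared_rotz_legendrian[OF f]
          phase_sheared_rotz[OF f assms(2)] mult.assoc)
  qed (use H k in auto)
qed

text \<open>The spin loop and the constant loop are homotopic in \<open>K\<close> but not in
  \<open>L\<close>. Every base point in \<open>L\<close> is the class of a Legendrian embedding,
  which can itself be spun.\<close>

lemma not_inj_fundamental_group_map:
  assumes L: "L \<in> legendrian_knot_types" and K: "K \<in> smooth_knot_types" and "L \<subseteq> K"
    and k: "k \<in> L" "knot_phase k \<noteq> 0"
  shows "\<not> inj_on (fundamental_group_map (subtopology Emb_space K) id k)
    (carrier (fundamental_group (subtopology Leg_space L) k))"
proof
  let ?X = "subtopology Leg_space L" and ?Y = "subtopology Emb_space K"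
  assume inj: "inj_on (fundamental_group_map ?Y id k) (carrier (fundamental_group ?X k))"
  have "L \<subseteq> topspace Leg_space"
    using L by (simp add: legendrian_knot_types_def connected_components_of_subset)
  then obtain f where f: "f \<in> legendrian_embeddings" "k = knot_class f"
    using k(1) by (auto simp: topspace_Leg_space)
  have phase: "phase f \<noteq> 0" using k(2) f knot_phase_knot_class by simp
  have fk: "f \<in> knot_embeddings" using f by (simp add: legendrian_embeddings_def)
  have p: "spin_loop f \<in> loops ?X k" using spin_loop_loops[OF f(1) L] k(1) f(2) by simp
  have c: "(\<lambda>_. k) \<in> loops ?X k"
    using k(1) \<open>L \<subseteq> topspace Leg_space\<close> by (intro const_loops) auto
  have id: "continuous_map ?X ?Y id" by (rule continuous_map_knot_type_inclusion) fact
  have hom: "loop_homotopic ?Y k (spin_loop f) (\<lambda>_. k)"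
    using spin_loop_null_homotopic_Emb[OF fk K] k(1) \<open>L \<subseteq> K\<close> f(2) by auto
  have "fundamental_group_map ?Y id k (loop_class ?X k (spin_loop f)) =
      fundamental_group_map ?Y id k (loop_class ?X k (\<lambda>_. k))"
    using fundamental_group_map_class[OF id p] fundamental_group_map_class[OF id c]
    by (simp add: loop_class_eqI[OF hom])
  then have "loop_class ?X k (spin_loop f) = loop_class ?X k (\<lambda>_. k)"
    by (rule inj_onD[OF inj]) (simp_all add: fundamental_group_def p c)
  then have "loop_homotopic ?X k (spin_loop f) (\<lambda>_. k)" by (simp add: loop_class_eq_iff[OF c])
  then show False using spin_loop_essential_Leg[OF f(1) phase L] k(1) f(2) by simp
qed

lemma legendrian_knot_type_smooth:
  assumes "L \<in> legendrian_knot_types"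
  obtains K where "K \<in> smooth_knot_types" "L \<subseteq> K"
proof -
  have "L \<noteq> {}" using assms nonempty_connected_components_of by (auto simp: legendrian_knot_types_def)
  then obtain k where k: "k \<in> L" by blast
  have "connectedin Leg_space L"
    using assms by (simp add: legendrian_knot_types_def connectedin_connected_components_of)
  from connectedin_continuous_map_image[OF continuous_map_Leg_Emb this]
  have L: "connectedin Emb_space L" by simp
  have "L \<subseteq> connected_component_of_set Emb_space k"
    by (rule connected_component_of_maximal[OF L k])
  moreover have "k \<in> topspace Emb_space" using connectedin_subset_topspace[OF L] k by blast
  ultimately show thesis
    by (intro that[of "connected_component_of_set Emb_space k"])
      (simp_all add: smooth_knot_types_def connected_components_of_def)
qed

section \<open>A Legendrian knot with rotation number 0\<close>

lemma smooth_sin_affine: "smooth (\<lambda>t. sin (a * t + b))" for a b :: real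
proof -
  have "sin (a * t + b) = cos (a * t + (b - pi / 2))" for t
    by (simp add: cos_diff cos_add sin_add algebra_simps)
  then show ?thesis by (simp add: smooth_cos_affine)
qed

text \<open>The (x, y)-projection is a figure eight, whose lobes turn the tangent in opposite
  senses; the third coordinate is an antiderivative of y dx.\<close>

definition bow_tie :: "real \<Rightarrow> real^3"
  where "bow_tie t = sin (2 * pi * t) *\<^sub>R axis 1 1 + sin (4 * pi * t) *\<^sub>R axis 2 1
    + (-2/3 * cos (2 * pi * t) ^ 3) *\<^sub>R axis 3 1"

lemma bow_tie_nth:
  "bow_tie t $ 1 = sin (2 * pi * t)" "bow_tie t $ 2 = sin (4 * pi * t)"
  "bow_tie t $ 3 = -2/3 * cos (2 * pi * t) ^ 3"
  by (simp_all add: bow_tie_def axis_def)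

lemma bow_tie_smooth_circle_map: "bow_tie \<in> smooth_circle_maps"
proof -
  have "smooth bow_tie"
    unfolding bow_tie_def[abs_def] power3_eq_cube
    using smooth_sin_affine[of _ 0] smooth_cos_affine[of _ 0]
    by (intro smooth_add smooth_scaleR smooth_mult smooth_const) simp_all
  moreover have "sin (2 * pi * (t + 1)) = sin (2 * pi * t)" "sin (4 * pi * (t + 1)) = sin (4 * pi * t)"
    "cos (2 * pi * (t + 1)) = cos (2 * pi * t)" for t
  proof -
    have "2 * pi * (t + 1) = 2 * pi * t + 2 * pi" "4 * pi * (t + 1) = (4 * pi * t + 2 * pi) + 2 * pi"
      by (simp_all add: algebra_simps)
    then show "sin (2 * pi * (t + 1)) = sin (2 * pi * t)" "sin (4 * pi * (t + 1)) = sin (4 * pi * t)"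
      "cos (2 * pi * (t + 1)) = cos (2 * pi * t)" by (simp_all only: sin_periodic cos_periodic)
  qed
  ultimately show ?thesis by (simp add: smooth_circle_maps_def bow_tie_def)
qed

lemma vector_derivative_bow_tie_nth:
  "vector_derivative bow_tie (at t) $ 1 = 2 * pi * cos (2 * pi * t)"
  "vector_derivative bow_tie (at t) $ 2 = 4 * pi * cos (4 * pi * t)"
  "vector_derivative bow_tie (at t) $ 3 = 4 * pi * (cos (2 * pi * t))\<^sup>2 * sin (2 * pi * t)"
proof -
  have nth: "((\<lambda>t. bow_tie t $ i) has_real_derivative vector_derivative bow_tie (at t) $ i) (at t)" for i
    unfolding has_real_derivative_iff_has_vector_derivative
    using bow_tie_smooth_circle_map
    by (intro bounded_linear.has_vector_derivative[OF bounded_linear_vec_nth] smooth_has_vector_derivative)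
      (simp add: smooth_circle_maps_def)
  show "vector_derivative bow_tie (at t) $ 1 = 2 * pi * cos (2 * pi * t)"
    using nth[of 1] unfolding bow_tie_nth by (rule DERIV_unique) (auto intro!: derivative_eq_intros)
  show "vector_derivative bow_tie (at t) $ 2 = 4 * pi * cos (4 * pi * t)"
    using nth[of 2] unfolding bow_tie_nth by (rule DERIV_unique) (auto intro!: derivative_eq_intros)
  show "vector_derivative bow_tie (at t) $ 3 = 4 * pi * (cos (2 * pi * t))\<^sup>2 * sin (2 * pi * t)"
    using nth[of 3] unfolding bow_tie_nth by (rule DERIV_unique) (auto intro!: derivative_eq_intros)
qed

lemma cos_4_pi: "cos (4 * pi * t) = 2 * (cos (2 * pi * t))\<^sup>2 - 1"
  using cos_double_cos[of "2 * pi * t"] by (simp add: mult.assoc)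

lemma bow_tie_legendrian: "bow_tie \<in> legendrian_embeddings"
proof -
  have "s - t \<in> \<int>" if "bow_tie s = bow_tie t" for s t
  proof -
    have "sin (2 * pi * s) = sin (2 * pi * t)" "cos (2 * pi * s) ^ 3 = cos (2 * pi * t) ^ 3"
      using that bow_tie_nth[of s] bow_tie_nth[of t] by simp_all
    \<comment> \<open>The third coordinate separates the crossing of the figure eight: cubing is
      injective, so it yields the cosine, which with the sine fixes the angle.\<close>
    then have "sin (2 * pi * s) = sin (2 * pi * t) \<and> cos (2 * pi * s) = cos (2 * pi * t)"
      by (metis odd_numeral odd_real_root_power_cancel)
    then obtain n :: int where "2 * pi * s = 2 * pi * t + 2 * pi * n"
      unfolding sin_cos_eq_iff by blast
    then have "2 * pi * (s - t) = 2 * pi * n" by (simp add: algebra_simps)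
    then have "s - t = of_int n" by simp
    then show ?thesis by simp
  qed
  moreover have "vector_derivative bow_tie (at t) \<noteq> 0" for t
  proof
    assume "vector_derivative bow_tie (at t) = 0"
    \<comment> \<open>Where the cosine vanishes, the double-angle formula makes
      \<open>cos (4 * pi * t)\<close> equal to -1.\<close>
    then have "cos (2 * pi * t) = 0" "cos (4 * pi * t) = 0"
      using vector_derivative_bow_tie_nth[of t] by simp_all
    then show False using cos_4_pi[of t] by simp
  qed
  moreover have "contact_form (bow_tie t) (vector_derivative bow_tie (at t)) = 0" for t
    using sin_double[of "2 * pi * t"]
    by (simp add: contact_form_def vector_derivative_bow_tie_nth bow_tie_nth power2_eq_square mult.assoc)
  ultimately show ?thesis
    using bow_tie_smooth_circle_map by (simp add: legendrian_embeddings_def knot_embeddings_def)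
qed

text \<open>
  The velocity runs back and forth on an arc of a parabola that misses the positive imaginary
  axis, where \<open>Ln (\<i> w)\<close> is discontinuous.
\<close>

lemma phase_bow_tie: "phase bow_tie \<noteq> 0"
proof -
  let ?w = "\<lambda>t. \<i> * tangent bow_tie t"
  have w: "?w t \<notin> \<real>\<^sub>\<le>\<^sub>0" for t
  proof
    assume "?w t \<in> \<real>\<^sub>\<le>\<^sub>0"
    then have "cos (2 * pi * t) = 0" "cos (4 * pi * t) \<ge> 0"
      using not_le[THEN iffD2, OF pi_gt_zero]
      by (auto simp: complex_nonpos_Reals_iff tangent_def vector_derivative_bow_tie_nth zero_le_mult_iff)
    then show False using cos_4_pi[of t] by simp
  qed
  \<comment> \<open>Multiplying by i moves the velocity off the branch cut; squared it contributes
    -1, which the shift by \<open>pi\<close> compensates.\<close>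
  have "phase_lift bow_tie (\<lambda>t. 2 * Im (Ln (?w t)) - pi)"
    unfolding phase_lift_def
  proof (intro conjI allI)
    show "continuous_on UNIV (\<lambda>t. 2 * Im (Ln (?w t)) - pi)"
      using w by (intro continuous_intros continuous_on_tangent bow_tie_legendrian)
    show "2 * Im (Ln (?w (t + 1))) - pi = 2 * Im (Ln (?w t)) - pi" for t
      by (simp add: tangent_periodic[OF bow_tie_legendrian])
    show "(sgn (tangent bow_tie t))\<^sup>2 = cis (2 * Im (Ln (?w t)) - pi)" for t
    proof -
      have "?w t \<noteq> 0" using tangent_nonzero[OF bow_tie_legendrian] by simp
      then have "sgn (?w t) = cis (Im (Ln (?w t)))" by (metis cis_Arg Arg_eq_Im_Ln)
      moreover have "sgn (?w t) = \<i> * sgn (tangent bow_tie t)" by (simp add: sgn_mult sgn_eq[of \<i>])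
      ultimately have "(\<i> * sgn (tangent bow_tie t))\<^sup>2 = cis (2 * Im (Ln (?w t)))"
        by (simp add: power2_eq_square cis_mult)
      then have "(sgn (tangent bow_tie t))\<^sup>2 = - cis (2 * Im (Ln (?w t)))"
        by (simp add: power_mult_distrib) (metis minus_minus)
      then show ?thesis by (simp add: cis_divide[symmetric])
    qed
  qed
  then show ?thesis using phase_eq by auto
qed

theorem corollary1p4:
  shows "\<exists>\<L>\<in>legendrian_knot_types. \<exists>\<K>\<in>smooth_knot_types. \<L> \<subseteq> \<K> \<and>
    (\<forall>k\<in>\<L>. \<not> inj_on (fundamental_group_map (subtopology Emb_space \<K>) id k)
                     (carrier (fundamental_group (subtopology Leg_space \<L>) k)))"
proof -
  let ?k = "knot_class bow_tie"
  let ?L = "connected_component_of_set Leg_space ?k"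
  have k: "?k \<in> topspace Leg_space" by (simp add: topspace_Leg_space bow_tie_legendrian)
  then have L: "?L \<in> legendrian_knot_types"
    unfolding legendrian_knot_types_def connected_components_of_def by blast
  obtain K where K: "K \<in> smooth_knot_types" "?L \<subseteq> K" using legendrian_knot_type_smooth[OF L] .
  have "?k \<in> ?L" using k by (simp add: connected_component_of_refl)
  moreover have "knot_phase ?k \<noteq> 0"
    by (simp add: knot_phase_knot_class[OF bow_tie_legendrian] phase_bow_tie)
  \<comment> \<open>Nonvanishing of the phase spreads from the bow tie over its component, which
    gives the claim at every base point.\<close>
  ultimately have "knot_phase l \<noteq> 0" if "l \<in> ?L" for l
    using knot_phase_nonzero[OF connectedin_connected_component_of that] by blast
  with L K show ?thesis using not_inj_fundamental_group_map by blast
qed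

end
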